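(* Let $\mu=\sum_{i=1}^m p_i\delta_{x_i}$ be a finitely supported centered probability measure on $\mathbb{R}^n$ (with $x_1,\dots,x_m\in\mathbb{R}^n$ distinct, $p_i>0$, $\sum_i p_i=1$), and let $\nu$ be a centered probability measure on $\mathbb{R}^n$ which is absolutely continuous with respect to the Lebesgue measure and has finite first moments. Assume that $\mu\preceq_{\mathrm{cx}}\nu$, and let $X\sim\mu$, $Y\sim\nu$. Let $\mathcal{C}$ be the collection of tuples $(f_1,\dots,f_m)$ of nonnegative functions $f_i:\mathbb{R}^n\to\mathbb{R}$ (defined up to $\nu$-null sets) satisfying $$\sum_{i=1}^m p_i f_i(x)=1,\qquad \mathbb{E}[f_i(Y)]=1,\qquad \mathbb{E}[Y f_i(Y)]=x_i \quad (1\le i\le m).$$ Then: 1. There is a natural bijection between the set of martingale couplings $(X,Y)$ of $\mu$ and $\nu$ and the collection $\mathcal{C}$, sending a martingale coupling $(X,Y)$ to the tuple $f_i(y)=\mathbb{P}(X=x_i\mid Y=y)/\mathbb{P}(X=x_i)$, $1\le i\le m$. 2. One has $X\preceq_{\mathrm{cx}}(1-\varepsilon)Y$ for some $\varepsilon\in(0,1)$ if and only if there exists $(f_1^*,\dots,f_m^* )\in\mathcal{C}$ such that each $f_i^*$ is of the form $$f_i^*(x)=\frac{e^{U_i+\langle V_i,x\rangle}}{\sum_{j=1}^m p_j e^{U_j+\langle V_j,x\rangle}}$$ for some $U_1,\dots,U_m\in\mathbb{R}$ and $V_1,\dots,V_m\in\mathbb{R}^n$. Moreover, each such $f_i^*$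 is log-concave.
   Context: For random vectors $X,Y$ in $\mathbb{R}^n$, $X\preceq_{\mathrm{cx}}Y$ means $\mathbb{E}[f(X)]\leq\mathbb{E}[f(Y)]$ for every convex $f:\mathbb{R}^n\to\mathbb{R}$; for probability measures, $\mu\preceq_{\mathrm{cx}}\nu$ means $X\preceq_{\mathrm{cx}}Y$ for $X\sim\mu$, $Y\sim\nu$. A measure is centered if its mean is $0$. A martingale coupling of $\mu$ and $\nu$ is a pair $(X,Y)$ on a common probability space with $X\sim\mu$, $Y\sim\nu$ and $\mathbb{E}[Y\mid X]=X$; couplings are identified with their joint laws. A function $f:\mathbb{R}^n\to[0,\infty)$ is log-concave if $f=e^{-V}$ with $V:\mathbb{R}^n\to\mathbb{R}\cup\{\infty\}$ convex, twice differentiable on the interior of $\{V<\infty\}$ (so that $\mathrm{Hess}\,V\geq 0$ there). *)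

theory Defs
  imports "HOL-Probability.Probability"
begin

text \<open>
  Expectation with values in the extended reals. The Bochner integral of a non-integrable function
  is 0 by convention, which is the wrong value for a convex function whose expectation is infinite.
  For a convex function of an integrable random vector the negative part is integrable (the function
  has an affine minorant), so the difference below is never of the form \<open>\<infinity> - \<infinity>\<close>.
\<close>

definition ext_expectation :: "'s measure \<Rightarrow> ('s \<Rightarrow> real) \<Rightarrow> ereal" where
  "ext_expectation M g =
     enn2ereal (\<integral>\<^sup>+ \<omega>. ennreal (g \<omega>) \<partial>M) - enn2ereal (\<integral>\<^sup>+ \<omega>. ennreal (- g \<omega>) \<partial>M)"

definition convex_order ::
    "'s measure \<Rightarrow> ('s \<Rightarrow> 'a::euclidean_space) \<Rightarrow> 't measure \<Rightarrow> ('t \<Rightarrow> 'a) \<Rightarrow> bool" where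
  "convex_order M X N Y \<longleftrightarrow>
     (\<forall>g. convex_on UNIV g \<longrightarrow>
        ext_expectation M (\<lambda>\<omega>. g (X \<omega>)) \<le> ext_expectation N (\<lambda>\<omega>. g (Y \<omega>)))"

definition measure_convex_order :: "'a::euclidean_space measure \<Rightarrow> 'a measure \<Rightarrow> bool" where
  "measure_convex_order \<mu> \<nu> \<longleftrightarrow> convex_order \<mu> (\<lambda>x. x) \<nu> (\<lambda>y. y)"

text \<open>The conditional expectation \<open>\<E>[Y | X] = X\<close> is stated coordinatewise.\<close>

definition martingale_coupling ::
    "'s measure \<Rightarrow> ('s \<Rightarrow> 'a::euclidean_space) \<Rightarrow> ('s \<Rightarrow> 'a) \<Rightarrow> 'a measure \<Rightarrow> 'a measure \<Rightarrow> bool" where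
  "martingale_coupling M X Y \<mu> \<nu> \<longleftrightarrow>
     prob_space M \<and> X \<in> borel_measurable M \<and> Y \<in> borel_measurable M \<and>
     distr M borel X = \<mu> \<and> distr M borel Y = \<nu> \<and> integrable M Y \<and>
     (\<forall>b\<in>Basis. AE \<omega> in M.
        real_cond_exp M (vimage_algebra (space M) X borel) (\<lambda>\<omega>. Y \<omega> \<bullet> b) \<omega> = X \<omega> \<bullet> b)"

text \<open>
  Couplings are identified with their joint laws; a joint law is represented by the coordinate pair
  on the product space.
\<close>

definition martingale_coupling_laws ::
    "'a::euclidean_space measure \<Rightarrow> 'a measure \<Rightarrow> ('a \<times> 'a) measure set" where
  "martingale_coupling_laws \<mu> \<nu> =
     {\<pi>. sets \<pi> = sets (borel \<Otimes>\<^sub>M borel) \<and> martingale_coupling \<pi> fst snd \<mu> \<nu>}"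

text \<open>
  A version of \<open>y \<mapsto> \<P>(A | Y = y)\<close>: a Borel function whose composition with \<open>Y\<close> is the
  conditional expectation of the indicator of \<open>A\<close> given the \<open>\<sigma>\<close>-algebra generated by \<open>Y\<close>.
  It is unique up to null sets of the law of \<open>Y\<close>.
\<close>

definition cond_prob_given ::
    "'s measure \<Rightarrow> 's set \<Rightarrow> ('s \<Rightarrow> 'a::euclidean_space) \<Rightarrow> 'a \<Rightarrow> real" where
  "cond_prob_given M A Y =
     (SOME g. g \<in> borel_measurable borel \<and>
        (AE \<omega> in M. g (Y \<omega>) =
           real_cond_exp M (vimage_algebra (space M) Y borel) (indicator A) \<omega>))"

definition coupling_tuple ::
    "'s measure \<Rightarrow> ('s \<Rightarrow> 'a::euclidean_space) \<Rightarrow> ('s \<Rightarrow> 'a) \<Rightarrow> ('m \<Rightarrow> 'a) \<Rightarrow> 'm \<Rightarrow> 'a \<Rightarrow> real" where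
  "coupling_tuple M X Y x i y =
     cond_prob_given M {\<omega> \<in> space M. X \<omega> = x i} Y y / measure M {\<omega> \<in> space M. X \<omega> = x i}"

text \<open>
  Representatives of the members of the collection \<open>\<C>\<close>; as these are only defined up to null sets
  of the law of \<open>Y\<close>, the pointwise requirements are almost everywhere. The tuple is indexed by a
  finite type.
\<close>

definition admissible_tuples ::
    "'t measure \<Rightarrow> ('t \<Rightarrow> 'a::euclidean_space) \<Rightarrow> ('m::finite \<Rightarrow> real) \<Rightarrow> ('m \<Rightarrow> 'a)
      \<Rightarrow> ('m \<Rightarrow> 'a \<Rightarrow> real) set" where
  "admissible_tuples N Y p x =
     {f. (\<forall>i. f i \<in> borel_measurable borel \<and> (AE y in distr N borel Y. 0 \<le> f i y)) \<and>
         (AE y in distr N borel Y. (\<Sum>i\<in>UNIV. p i * f i y) = 1) \<and>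
         (\<forall>i. has_bochner_integral N (\<lambda>\<omega>. f i (Y \<omega>)) 1 \<and>
              has_bochner_integral N (\<lambda>\<omega>. f i (Y \<omega>) *\<^sub>R Y \<omega>) (x i))}"

definition ae_eq_tuples ::
    "'a measure \<Rightarrow> ('m \<Rightarrow> 'a \<Rightarrow> real) set \<Rightarrow> (('m \<Rightarrow> 'a \<Rightarrow> real) \<times> ('m \<Rightarrow> 'a \<Rightarrow> real)) set" where
  "ae_eq_tuples \<nu> C = {(f, g). f \<in> C \<and> g \<in> C \<and> (\<forall>i. AE y in \<nu>. f i y = g i y)}"

definition gibbs_tuple ::
    "('m::finite \<Rightarrow> real) \<Rightarrow> ('m \<Rightarrow> real) \<Rightarrow> ('m \<Rightarrow> 'a::real_inner) \<Rightarrow> 'm \<Rightarrow> 'a \<Rightarrow> real" where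
  "gibbs_tuple p U V i y = exp (U i + V i \<bullet> y) / (\<Sum>j\<in>UNIV. p j * exp (U j + V j \<bullet> y))"

text \<open>Convexity of an extended real valued function; the arithmetic of \<^typ>\<open>ereal\<close> has \<open>0 * \<infinity> = 0\<close>.\<close>

definition ereal_convex :: "('a::real_vector \<Rightarrow> ereal) \<Rightarrow> bool" where
  "ereal_convex V \<longleftrightarrow>
     (\<forall>x y u v. 0 \<le> u \<longrightarrow> 0 \<le> v \<longrightarrow> u + v = 1 \<longrightarrow>
        V (u *\<^sub>R x + v *\<^sub>R y) \<le> ereal u * V x + ereal v * V y)"

definition twice_differentiable_on_open :: "('a::euclidean_space \<Rightarrow> real) \<Rightarrow> 'a set \<Rightarrow> bool" where
  "twice_differentiable_on_open g S \<longleftrightarrow>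
     (\<exists>G. \<forall>x\<in>S. GDERIV g x :> G x \<and> G differentiable (at x))"

definition log_concave :: "('a::euclidean_space \<Rightarrow> real) \<Rightarrow> bool" where
  "log_concave f \<longleftrightarrow>
     (\<exists>V :: 'a \<Rightarrow> ereal.
        (\<forall>x. V x \<noteq> -\<infinity>) \<and> ereal_convex V \<and>
        twice_differentiable_on_open (\<lambda>x. real_of_ereal (V x)) (interior {x. V x < \<infinity>}) \<and>
        (\<forall>x. f x = (if V x = \<infinity> then 0 else exp (- real_of_ereal (V x)))))"

end

(*
  A coupling of \<mu> with \<nu> is determined by the masses of the slices {x i} \<times> B, and these are the
  integrals over B of p i * f i against \<nu>; this gives the bijection.

  Put Z = (1, Y), so that the two moment conditions on f i become E[f i Z] = (1, x i). Gibbs tuples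
  in C are the critical points of the convex function
    w |-> E[ln (sum_i p i exp (w i . Z))] - sum_i p i (w i . (1, x i)).
  The log-sum-exp is at least max_i (w i . Z) - const, and the convex order X <= (1 - \<epsilon>) Y applied to
  the convex function max_i makes the difference at least \<epsilon> E[max_i (w i . Z)] - const on the
  subspace sum_i p i w i = 0. There E[max_i (w i . Z)] is positively homogeneous and vanishes only
  at 0, because \<nu> charges no hyperplane. Hence the function is coercive and a minimizer exists.

  Conversely a Gibbs tuple is strictly positive, so it can be perturbed to weights h i with
  E[h i] = 1 and E[Y h i] = (1 + \<delta>) x i; averaging affine minorants against h i gives
  X <= (1 - \<epsilon>) Y with 1 - \<epsilon> = 1 / (1 + \<delta>).
*)
theory Submission
  imports Defs
begin

text \<open>The obstacle is that \<open>Y\<close> has only a first moment, so every estimate must be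
  at most linear in \<open>norm Z\<close>. Log-sum-exp and the maximum are 1-Lipschitz for the
  supremum norm: this makes their expectations finite and continuous and dominates difference
  quotients. In the converse, an undamped perturbation \<open>(v \<bullet> Z) *\<^sub>R Z\<close>
  need not be integrable, so its weight carries the factor \<open>1 / (1 + norm Z)\<close>. The gain
  of \<epsilon> E[max] has the following source: \<open>(1, x i)\<close> is the convex combination,
  with weights 1 - \<epsilon> and \<epsilon>, of the point
  \<open>(1, x i / (1 - \<epsilon>))\<close> and the mean \<open>(1, 0)\<close> of Z. On the
  subspace the mean contributes nothing, so the linear term uses up only the fraction 1 - \<epsilon>
  of E[max]. With \<epsilon> = 0 the same estimate yields a lower bound but no coercivity. The
  constant coordinate of Z also turns "no mass on affine hyperplanes" into linear nondegeneracy,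
  which both directions use: once for coercivity and once for inverting a Gram operator.\<close>

section \<open>Log-sum-exp\<close>

definition lse :: "('m::finite \<Rightarrow> real) \<Rightarrow> ('m \<Rightarrow> real) \<Rightarrow> real" where
  "lse p a = ln (\<Sum>i\<in>UNIV. p i * exp (a i))"

lemma weighted_exp_sum_pos:
  fixes p :: "'m::finite \<Rightarrow> real"
  assumes "\<forall>i. 0 < p i"
  shows "0 < (\<Sum>i\<in>UNIV. p i * exp (a i))"
  by (intro sum_pos) (auto simp: assms)

lemma exp_lse:
  fixes p :: "'m::finite \<Rightarrow> real"
  assumes "\<forall>i. 0 < p i"
  shows "exp (lse p a) = (\<Sum>i\<in>UNIV. p i * exp (a i))"
  using weighted_exp_sum_pos[OF assms] by (simp add: lse_def)

lemma lse_mono_shift: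
  fixes p :: "'m::finite \<Rightarrow> real"
  assumes p: "\<forall>i. 0 < p i" and le: "\<And>i. a i \<le> b i + c"
  shows "lse p a \<le> lse p b + c"
proof -
  have "exp (lse p a) \<le> exp (lse p b + c)"
    unfolding exp_add exp_lse[OF p] sum_distrib_right
    by (intro sum_mono) (use p le in \<open>auto simp: mult.assoc less_imp_le simp flip: exp_add\<close>)
  then show ?thesis by simp
qed

lemma lse_ge:
  fixes p :: "'m::finite \<Rightarrow> real"
  assumes p: "\<forall>i. 0 < p i"
  shows "a i + ln (p i) \<le> lse p a"
proof -
  have "p i * exp (a i) \<le> (\<Sum>j\<in>UNIV. p j * exp (a j))"
    by (rule member_le_sum) (auto simp: p less_imp_le)
  then have "exp (a i + ln (p i)) \<le> exp (lse p a)"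
    using p by (simp add: exp_lse exp_add mult.commute)
  then show ?thesis by simp
qed

text \<open>Holder's inequality in disguise: after subtracting \<open>lse p a\<close> and
  \<open>lse p b\<close> both weighted exponential sums equal 1, so pointwise convexity of
  \<open>exp\<close> bounds the mixed sum by \<open>u + v = 1\<close>. Undoing the normalization
  gives the claim.\<close>

lemma lse_convex:
  fixes p :: "'m::finite \<Rightarrow> real"
  assumes p: "\<forall>i. 0 < p i" and uv: "0 \<le> u" "0 \<le> v" "u + v = 1"
  shows "lse p (\<lambda>i. u * a i + v * b i) \<le> u * lse p a + v * lse p b"
proof -
  let ?A = "lse p a" and ?B = "lse p b"
  have norm: "(\<Sum>i\<in>UNIV. p i * exp (c i - lse p c)) = 1" for c
    using weighted_exp_sum_pos[OF p, of c]
    by (simp add: exp_diff exp_lse[OF p] flip: sum_divide_distrib)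
  have "exp (u * (a i - ?A) + v * (b i - ?B)) \<le> u * exp (a i - ?A) + v * exp (b i - ?B)" for i
  proof -
    have "u = 1 - v" using uv by simp
    show ?thesis
      using convex_onD[OF exp_convex, of v "a i - ?A" "b i - ?B"] uv by (simp add: \<open>u = 1 - v\<close>)
  qed
  then have "(\<Sum>i\<in>UNIV. p i * exp (u * (a i - ?A) + v * (b i - ?B)))
      \<le> (\<Sum>i\<in>UNIV. p i * (u * exp (a i - ?A) + v * exp (b i - ?B)))"
    by (intro sum_mono mult_left_mono) (auto simp: p less_imp_le)
  also have "\<dots> = u * (\<Sum>i\<in>UNIV. p i * exp (a i - ?A)) + v * (\<Sum>i\<in>UNIV. p i * exp (b i - ?B))"
    by (simp add: sum.distrib sum_distrib_left algebra_simps)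
  also have "\<dots> = 1" using uv by (simp add: norm)
  finally have le: "(\<Sum>i\<in>UNIV. p i * exp (u * (a i - ?A) + v * (b i - ?B))) \<le> 1" .
  have "exp (lse p (\<lambda>i. u * a i + v * b i))
     = exp (u * ?A + v * ?B) * (\<Sum>i\<in>UNIV. p i * exp (u * (a i - ?A) + v * (b i - ?B)))"
    unfolding exp_lse[OF p] sum_distrib_left
    by (intro sum.cong) (auto simp: mult.left_commute algebra_simps simp flip: exp_add)
  also have "\<dots> \<le> exp (u * ?A + v * ?B)" using le by simp
  finally show ?thesis by simp
qed

text \<open>The derivative is the average of \<open>d\<close> under the Gibbs probabilities. This is
  why critical points of the expected log-sum-exp solve moment equations for Gibbs weights.\<close>

lemma lse_has_derivative_along:
  fixes p :: "'m::finite \<Rightarrow> real"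
  assumes p: "\<forall>i. 0 < p i"
  shows "((\<lambda>t. lse p (\<lambda>i. a i + t * d i)) has_real_derivative
           (\<Sum>i\<in>UNIV. p i * exp (a i) * d i) / (\<Sum>i\<in>UNIV. p i * exp (a i))) (at 0)"
proof -
  have "((\<lambda>t. \<Sum>i\<in>UNIV. p i * exp (a i + t * d i)) has_real_derivative
      (\<Sum>i\<in>UNIV. p i * exp (a i) * d i)) (at 0)"
    by (rule DERIV_sum) (auto intro!: derivative_eq_intros)
  from DERIV_chain2[OF DERIV_ln_divide this] weighted_exp_sum_pos[OF p, of a] show ?thesis
    by (simp add: lse_def)
qed

text \<open>
  Shared by \<^term>\<open>lse p\<close> and the maximum; it already implies that the function is 1-Lipschitz for
  the supremum norm, which is all that integrability and continuity of the expectations below need.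
\<close>

definition shift_mono :: "(('m \<Rightarrow> real) \<Rightarrow> real) \<Rightarrow> bool" where
  "shift_mono h \<longleftrightarrow> (\<forall>a b c. (\<forall>i. a i \<le> b i + c) \<longrightarrow> h a \<le> h b + c)"

lemma shift_monoD: "shift_mono h \<Longrightarrow> (\<And>i. a i \<le> b i + c) \<Longrightarrow> h a \<le> h b + c"
  by (auto simp: shift_mono_def)

lemma shift_mono_lse:
  fixes p :: "'m::finite \<Rightarrow> real"
  shows "\<forall>i. 0 < p i \<Longrightarrow> shift_mono (lse p)"
  by (auto simp: shift_mono_def intro: lse_mono_shift)

lemma shift_mono_Max: "shift_mono (\<lambda>a. Max (range (a :: 'm::finite \<Rightarrow> real)))"
proof -
  have "Max (range a) \<le> Max (range b) + c" if *: "\<And>i. a i \<le> b i + c" for a b :: "'m \<Rightarrow> real" and c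
  proof -
    have "a i \<le> Max (range b) + c" for i
      using *[of i] Max_ge[OF finite_imageI[OF finite[of UNIV]] rangeI, of b i] by linarith
    then show ?thesis by auto
  qed
  then show ?thesis by (auto simp: shift_mono_def)
qed

lemma shift_mono_Lipschitz:
  fixes h :: "('m::finite \<Rightarrow> real) \<Rightarrow> real"
  assumes h: "shift_mono h"
    and "\<And>i. \<bar>a i - b i\<bar> \<le> c"
  shows "\<bar>h a - h b\<bar> \<le> c"
proof -
  have "h a \<le> h b + c" "h b \<le> h a + c"
    by (rule shift_monoD[OF h], use assms(2) in \<open>simp add: abs_le_iff algebra_simps\<close>)+
  then show ?thesis by linarith
qed

text \<open>Cauchy-Schwarz in each block bounds all entries by the same multiple of
  \<open>norm z\<close>. The bound serves as integrable majorant, as Lipschitz estimate for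
  expectations and as domination of difference quotients.\<close>

lemma shift_mono_Lipschitz_params:
  fixes h :: "('m::finite \<Rightarrow> real) \<Rightarrow> real" and w w' :: "'b::euclidean_space ^ 'm"
  assumes h: "shift_mono h"
  shows "\<bar>h (\<lambda>i. w $ i \<bullet> z) - h (\<lambda>i. w' $ i \<bullet> z)\<bar> \<le> norm (w - w') * norm z"
proof (rule shift_mono_Lipschitz[OF h])
  fix i
  have "\<bar>w $ i \<bullet> z - w' $ i \<bullet> z\<bar> = \<bar>(w - w') $ i \<bullet> z\<bar>"
    by (simp add: inner_diff_left)
  also have "\<dots> \<le> norm ((w - w') $ i) * norm z"
    by (rule Cauchy_Schwarz_ineq2)
  also have "\<dots> \<le> norm (w - w') * norm z"
    by (intro mult_right_mono Finite_Cartesian_Product.norm_nth_le norm_ge_zero)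
  finally show "\<bar>w $ i \<bullet> z - w' $ i \<bullet> z\<bar> \<le> norm (w - w') * norm z" .
qed

lemma shift_mono_measurable:
  fixes h :: "('m::finite \<Rightarrow> real) \<Rightarrow> real" and w :: "'b::euclidean_space ^ 'm"
  assumes h: "shift_mono h"
  shows "(\<lambda>z. h (\<lambda>i. w $ i \<bullet> z)) \<in> borel_measurable borel"
proof (rule borel_measurable_continuous_onI, rule lipschitz_on_continuous_on)
  show "(norm w)-lipschitz_on UNIV (\<lambda>z. h (\<lambda>i. w $ i \<bullet> z))"
  proof (rule lipschitz_onI)
    fix z z' :: 'b
    have "\<bar>w $ i \<bullet> z - w $ i \<bullet> z'\<bar> \<le> norm w * norm (z - z')" for i
    proof -
      have "\<bar>w $ i \<bullet> z - w $ i \<bullet> z'\<bar> \<le> norm (w $ i) * norm (z - z')"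
        using Cauchy_Schwarz_ineq2[of "w $ i" "z - z'"] by (simp add: inner_diff_right)
      also have "\<dots> \<le> norm w * norm (z - z')"
        by (intro mult_right_mono Finite_Cartesian_Product.norm_nth_le norm_ge_zero)
      finally show ?thesis .
    qed
    then show "dist (h (\<lambda>i. w $ i \<bullet> z)) (h (\<lambda>i. w $ i \<bullet> z')) \<le> norm w * dist z z'"
      unfolding dist_norm real_norm_def by (intro shift_mono_Lipschitz[OF h]) auto
  qed simp
qed

lemma shift_mono_integrable:
  fixes h :: "('m::finite \<Rightarrow> real) \<Rightarrow> real" and w :: "'b::euclidean_space ^ 'm"
  assumes "prob_space M" and Z: "integrable M Z"
    and h: "shift_mono h"
  shows "integrable M (\<lambda>\<omega>. h (\<lambda>i. w $ i \<bullet> Z \<omega>))"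
proof -
  interpret prob_space M by fact
    show ?thesis
  proof (rule Bochner_Integration.integrable_bound)
    show "integrable M (\<lambda>\<omega>. \<bar>h (\<lambda>i. 0)\<bar> + norm w * norm (Z \<omega>))"
      using Z by simp
    show "(\<lambda>\<omega>. h (\<lambda>i. w $ i \<bullet> Z \<omega>)) \<in> borel_measurable M"
      by (rule measurable_compose[OF borel_measurable_integrable[OF Z] shift_mono_measurable[OF h]])
    have "\<bar>h (\<lambda>i. w $ i \<bullet> z)\<bar> \<le> \<bar>h (\<lambda>i. 0)\<bar> + norm w * norm z" for z
      using shift_mono_Lipschitz_params[OF h, of w z 0]
      by simp
    then show "AE \<omega> in M. norm (h (\<lambda>i. w $ i \<bullet> Z \<omega>)) \<le> norm (\<bar>h (\<lambda>i. 0)\<bar> + norm w * norm (Z \<omega>))"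
      by (intro AE_I2) (simp add: abs_of_nonneg)
  qed
qed

text \<open>Continuity is needed for two minimizations over compact sets: of the expected maximum on
  a sphere and of the full functional on a ball.\<close>

lemma shift_mono_expectation_continuous:
  fixes h :: "('m::finite \<Rightarrow> real) \<Rightarrow> real"
  assumes "prob_space M" and Z: "integrable M (Z :: 's \<Rightarrow> 'b::euclidean_space)"
    and h: "shift_mono h"
  shows "continuous_on UNIV (\<lambda>w :: 'b ^ 'm. \<integral>\<omega>. h (\<lambda>i. w $ i \<bullet> Z \<omega>) \<partial>M)"
proof (rule lipschitz_on_continuous_on)
  show "(\<integral>\<omega>. norm (Z \<omega>) \<partial>M)-lipschitz_on UNIV (\<lambda>w :: 'b ^ 'm. \<integral>\<omega>. h (\<lambda>i. w $ i \<bullet> Z \<omega>) \<partial>M)"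
  proof (rule lipschitz_onI)
    fix w w' :: "'b ^ 'm"
    note int = shift_mono_integrable[OF assms(1) Z, of h, OF h]
    have "dist (\<integral>\<omega>. h (\<lambda>i. w $ i \<bullet> Z \<omega>) \<partial>M) (\<integral>\<omega>. h (\<lambda>i. w' $ i \<bullet> Z \<omega>) \<partial>M)
        = norm (\<integral>\<omega>. h (\<lambda>i. w $ i \<bullet> Z \<omega>) - h (\<lambda>i. w' $ i \<bullet> Z \<omega>) \<partial>M)"
      using int by (simp add: dist_norm)
    also have "\<dots> \<le> (\<integral>\<omega>. norm (h (\<lambda>i. w $ i \<bullet> Z \<omega>) - h (\<lambda>i. w' $ i \<bullet> Z \<omega>)) \<partial>M)"
      by (rule integral_norm_bound)
    also have "\<dots> \<le> (\<integral>\<omega>. norm (w - w') * norm (Z \<omega>) \<partial>M)"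
    proof (rule integral_mono)
      show "integrable M (\<lambda>\<omega>. norm (h (\<lambda>i. w $ i \<bullet> Z \<omega>) - h (\<lambda>i. w' $ i \<bullet> Z \<omega>)))"
        by (intro integrable_norm Bochner_Integration.integrable_diff int)
      show "integrable M (\<lambda>\<omega>. norm (w - w') * norm (Z \<omega>))" using Z by simp
      show "norm (h (\<lambda>i. w $ i \<bullet> Z \<omega>) - h (\<lambda>i. w' $ i \<bullet> Z \<omega>)) \<le> norm (w - w') * norm (Z \<omega>)" for \<omega>
        unfolding real_norm_def by (rule shift_mono_Lipschitz_params[OF h])
    qed
    finally show "dist (\<integral>\<omega>. h (\<lambda>i. w $ i \<bullet> Z \<omega>) \<partial>M) (\<integral>\<omega>. h (\<lambda>i. w' $ i \<bullet> Z \<omega>) \<partial>M)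
        \<le> (\<integral>\<omega>. norm (Z \<omega>) \<partial>M) * dist w w'"
      by (simp add: dist_norm mult.commute)
  qed simp
qed

section \<open>Minimizing the expected log-sum-exp\<close>

text \<open>Differentiation under the integral, in the one-sided form that minimality supplies: the
  expected difference quotients are at least \<open>c\<close>, hence so is their limit.\<close>

lemma lse_expectation_directional:
  fixes Z :: "'s \<Rightarrow> 'b::euclidean_space" and p :: "'m::finite \<Rightarrow> real" and w d :: "'b ^ 'm"
  assumes M: "prob_space M" and Z: "integrable M Z" and p: "\<forall>i. 0 < p i"
    and c: "\<And>t. 0 < t \<Longrightarrow> t * c \<le>
      (\<integral>\<omega>. lse p (\<lambda>i. (w + t *\<^sub>R d) $ i \<bullet> Z \<omega>) \<partial>M) - (\<integral>\<omega>. lse p (\<lambda>i. w $ i \<bullet> Z \<omega>) \<partial>M)"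
  shows "c \<le> (\<integral>\<omega>. (\<Sum>i\<in>UNIV. p i * exp (w $ i \<bullet> Z \<omega>) * (d $ i \<bullet> Z \<omega>)) /
                   (\<Sum>i\<in>UNIV. p i * exp (w $ i \<bullet> Z \<omega>)) \<partial>M)"
proof -
  interpret prob_space M by fact
  note h = shift_mono_lse[OF p]
  note [measurable] = borel_measurable_integrable[OF Z]
  let ?L = "\<lambda>w \<omega>. lse p (\<lambda>i. w $ i \<bullet> Z \<omega>)"
  let ?D = "\<lambda>\<omega>. (\<Sum>i\<in>UNIV. p i * exp (w $ i \<bullet> Z \<omega>) * (d $ i \<bullet> Z \<omega>)) /
                   (\<Sum>i\<in>UNIV. p i * exp (w $ i \<bullet> Z \<omega>))"
  define t where "t n = inverse (real (Suc n))" for n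
  have t: "0 < t n" for n by (simp add: t_def)
  have t0: "t \<longlonglongrightarrow> 0" unfolding t_def by (rule LIMSEQ_inverse_real_of_nat)
  let ?s = "\<lambda>n \<omega>. (?L (w + t n *\<^sub>R d) \<omega> - ?L w \<omega>) / t n"
  have int: "integrable M (?L v)" for v by (rule shift_mono_integrable[OF M Z h])
  have "(\<lambda>n. \<integral>\<omega>. ?s n \<omega> \<partial>M) \<longlonglongrightarrow> (\<integral>\<omega>. ?D \<omega> \<partial>M)"
  proof (rule integral_dominated_convergence)
    show "?D \<in> borel_measurable M" by measurable
    show "?s n \<in> borel_measurable M" for n
      using borel_measurable_integrable[OF int[of "w + t n *\<^sub>R d"]] borel_measurable_integrable[OF int[of w]] by simp
    \<comment> \<open>By the Lipschitz bound this majorant dominates the quotients for every step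
      size.\<close>
    show "integrable M (\<lambda>\<omega>. norm d * norm (Z \<omega>))" using Z by simp
    show "AE \<omega> in M. (\<lambda>n. ?s n \<omega>) \<longlonglongrightarrow> ?D \<omega>"
    proof (rule AE_I2)
      fix \<omega>
      have "((\<lambda>h. (lse p (\<lambda>i. w $ i \<bullet> Z \<omega> + h * (d $ i \<bullet> Z \<omega>)) - ?L w \<omega>) / h) \<longlongrightarrow> ?D \<omega>) (at 0)"
        using lse_has_derivative_along[OF p, of "\<lambda>i. w $ i \<bullet> Z \<omega>" "\<lambda>i. d $ i \<bullet> Z \<omega>"]
        by (simp add: DERIV_def)
      moreover have "filterlim t (at 0) sequentially"
        using t0 t by (auto simp: filterlim_at less_imp_neq[symmetric])
      ultimately have "((\<lambda>n. (lse p (\<lambda>i. w $ i \<bullet> Z \<omega> + t n * (d $ i \<bullet> Z \<omega>)) - ?L w \<omega>) / t n) \<longlongrightarrow> ?D \<omega>) sequentially"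
        by (rule filterlim_compose)
      then show "(\<lambda>n. ?s n \<omega>) \<longlonglongrightarrow> ?D \<omega>" by (simp add: inner_add_left)
    qed
    show "AE \<omega> in M. norm (?s n \<omega>) \<le> norm d * norm (Z \<omega>)" for n
    proof (rule AE_I2)
      fix \<omega>
      show "norm (?s n \<omega>) \<le> norm d * norm (Z \<omega>)"
        using shift_mono_Lipschitz_params[OF h, of "w + t n *\<^sub>R d" "Z \<omega>" w] t[of n]
        by (simp add: field_simps)
    qed
  qed
  moreover have "c \<le> (\<integral>\<omega>. ?s n \<omega> \<partial>M)" for n
  proof -
    have "(\<integral>\<omega>. ?s n \<omega> \<partial>M) = ((\<integral>\<omega>. ?L (w + t n *\<^sub>R d) \<omega> \<partial>M) - (\<integral>\<omega>. ?L w \<omega> \<partial>M)) / t n"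
      by (subst integral_divide_zero, subst Bochner_Integration.integral_diff) (rule int refl)+
    then show ?thesis using c[OF t, of n] t[of n] by (simp only: pos_le_divide_eq mult.commute)
  qed
  ultimately show ?thesis
    by (intro LIMSEQ_le_const) auto
qed

lemma gibbs_weight_le:
  fixes p :: "'m::finite \<Rightarrow> real"
  assumes p: "\<forall>i. 0 < p i"
  shows "p i * exp (a i) / (\<Sum>j\<in>UNIV. p j * exp (a j)) \<le> 1"
  using weighted_exp_sum_pos[OF p, of a] p
    member_le_sum[of i UNIV "\<lambda>j. p j * exp (a j)"] by (simp add: less_imp_le)

text \<open>Each summand of the denominator is at most the whole, so the weight is bounded by
  \<open>1 / p i\<close> and the first moment of \<open>Z\<close> suffices.\<close>

lemma integrable_gibbs_weight:
  fixes Z :: "'s \<Rightarrow> 'b::euclidean_space" and p :: "'m::finite \<Rightarrow> real"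
  assumes Z: "integrable M Z" and p: "\<forall>i. 0 < p i"
  shows "integrable M (\<lambda>\<omega>. (exp (w $ i \<bullet> Z \<omega>) / (\<Sum>j\<in>UNIV. p j * exp (w $ j \<bullet> Z \<omega>))) *\<^sub>R Z \<omega>)"
proof (rule Bochner_Integration.integrable_bound)
  note [measurable] = borel_measurable_integrable[OF Z]
  show "integrable M (\<lambda>\<omega>. norm (Z \<omega>) / p i)" using Z by simp
  show "(\<lambda>\<omega>. (exp (w $ i \<bullet> Z \<omega>) / (\<Sum>j\<in>UNIV. p j * exp (w $ j \<bullet> Z \<omega>))) *\<^sub>R Z \<omega>) \<in> borel_measurable M"
    by measurable
  show "AE \<omega> in M. norm ((exp (w $ i \<bullet> Z \<omega>) / (\<Sum>j\<in>UNIV. p j * exp (w $ j \<bullet> Z \<omega>))) *\<^sub>R Z \<omega>)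
      \<le> norm (norm (Z \<omega>) / p i)"
  proof (rule AE_I2)
    fix \<omega>
    let ?f = "exp (w $ i \<bullet> Z \<omega>) / (\<Sum>j\<in>UNIV. p j * exp (w $ j \<bullet> Z \<omega>))"
    have "0 \<le> ?f" using weighted_exp_sum_pos[OF p, of "\<lambda>j. w $ j \<bullet> Z \<omega>"] by simp
    moreover have "?f \<le> 1 / p i"
      using gibbs_weight_le[OF p, of i "\<lambda>j. w $ j \<bullet> Z \<omega>"] p by (simp add: field_simps)
    ultimately have "\<bar>?f\<bar> * norm (Z \<omega>) \<le> 1 / p i * norm (Z \<omega>)"
      by (intro mult_right_mono) auto
    then show "norm (?f *\<^sub>R Z \<omega>) \<le> norm (norm (Z \<omega>) / p i)"
      using p by (simp only: norm_scaleR) (simp add: less_imp_le)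
  qed
qed

text \<open>Moving only block \<open>i\<close> of \<open>w\<close> in direction \<open>v\<close>
  isolates one moment: the linear term changes at rate \<open>p i * (v \<bullet> y i)\<close>, the
  expected log-sum-exp at rate \<open>p i\<close> times \<open>v\<close> paired with the Gibbs
  moment.\<close>

lemma lse_minimizer_critical:
  fixes Z :: "'s \<Rightarrow> 'b::euclidean_space" and p :: "'m::finite \<Rightarrow> real" and w :: "'b ^ 'm"
  assumes M: "prob_space M" and Z: "integrable M Z" and p: "\<forall>i. 0 < p i"
    and min: "\<And>w'. (\<integral>\<omega>. lse p (\<lambda>i. w $ i \<bullet> Z \<omega>) \<partial>M) - (\<Sum>i\<in>UNIV. p i * (w $ i \<bullet> y i)) \<le>
       (\<integral>\<omega>. lse p (\<lambda>i. w' $ i \<bullet> Z \<omega>) \<partial>M) - (\<Sum>i\<in>UNIV. p i * (w' $ i \<bullet> y i))"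
  shows "(\<integral>\<omega>. (exp (w $ i \<bullet> Z \<omega>) / (\<Sum>j\<in>UNIV. p j * exp (w $ j \<bullet> Z \<omega>))) *\<^sub>R Z \<omega> \<partial>M) = y i"
    (is "?I = _")
proof -
  let ?f = "\<lambda>\<omega>. exp (w $ i \<bullet> Z \<omega>) / (\<Sum>j\<in>UNIV. p j * exp (w $ j \<bullet> Z \<omega>))"
  have "0 \<le> v \<bullet> (?I - y i)" for v
  proof -
    define d :: "'b ^ 'm" where "d = (\<chi> j. if j = i then v else 0)"
    have d: "d $ j \<bullet> z = (if j = i then v \<bullet> z else 0)" for j z by (simp add: d_def)
    have "p i * (v \<bullet> y i) \<le> (\<integral>\<omega>. (\<Sum>j\<in>UNIV. p j * exp (w $ j \<bullet> Z \<omega>) * (d $ j \<bullet> Z \<omega>)) /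
                   (\<Sum>j\<in>UNIV. p j * exp (w $ j \<bullet> Z \<omega>)) \<partial>M)"
    proof (rule lse_expectation_directional[OF M Z p])
      fix t :: real
      show "t * (p i * (v \<bullet> y i)) \<le> (\<integral>\<omega>. lse p (\<lambda>i. (w + t *\<^sub>R d) $ i \<bullet> Z \<omega>) \<partial>M) -
          (\<integral>\<omega>. lse p (\<lambda>i. w $ i \<bullet> Z \<omega>) \<partial>M)"
      proof -
        have "(\<Sum>j\<in>UNIV. p j * ((w + t *\<^sub>R d) $ j \<bullet> y j)) =
            (\<Sum>j\<in>UNIV. p j * (w $ j \<bullet> y j) + (if j = i then t * (p i * (v \<bullet> y i)) else 0))"
          by (intro sum.cong refl) (simp add: inner_add_left d distrib_left)
        also have "\<dots> = (\<Sum>j\<in>UNIV. p j * (w $ j \<bullet> y j)) + t * (p i * (v \<bullet> y i))"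
          by (simp add: sum.distrib)
        finally show ?thesis using min[of "w + t *\<^sub>R d"] by linarith
      qed
    qed
    also have "\<dots> = (\<integral>\<omega>. p i * (v \<bullet> (?f \<omega> *\<^sub>R Z \<omega>)) \<partial>M)"
      by (simp add: d if_distrib mult.assoc cong: if_cong)
    also have "\<dots> = p i * (v \<bullet> ?I)"
      using integral_inner_right[of v M, OF integrable_gibbs_weight[OF Z p, of w i]]
      by (simp only: integral_mult_right_zero)
    finally show ?thesis using p by (simp add: inner_diff_right)
  qed
  \<comment> \<open>The inequality holds for all directions, so it can be tested on minus the defect
    itself.\<close>
  from this[of "- (?I - y i)"] have "(?I - y i) \<bullet> (?I - y i) \<le> 0"
    by (simp only: inner_minus_left neg_0_le_iff_le)
  then have "?I - y i = 0" by (meson inner_gt_zero_iff not_le)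
  then show ?thesis by (simp only: right_minus_eq)
qed

text \<open>On the subspace the weighted mean of the entries
  \<open>w $ i \<bullet> Z \<omega>\<close> is 0, so their maximum is nonnegative. The constant is
  the minimum of the expected maximum over the unit sphere of the subspace, attained by
  compactness.\<close>

lemma Max_expectation_coercive:
  fixes Z :: "'s \<Rightarrow> 'b::euclidean_space" and p :: "'m::finite \<Rightarrow> real"
  assumes M: "prob_space M" and Z: "integrable M Z"
    and nondeg: "\<And>v. (AE \<omega> in M. v \<bullet> Z \<omega> = 0) \<Longrightarrow> v = 0"
    and p: "\<forall>i. 0 < p i" "(\<Sum>i\<in>UNIV. p i) = 1"
  obtains c where "0 < c"
    "\<And>w :: 'b ^ 'm. (\<Sum>i\<in>UNIV. p i *\<^sub>R w $ i) = 0 \<Longrightarrow> c * norm w \<le> (\<integral>\<omega>. Max (range (\<lambda>i. w $ i \<bullet> Z \<omega>)) \<partial>M)"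
proof -
  interpret prob_space M by fact
  let ?G = "\<lambda>w :: 'b ^ 'm. \<integral>\<omega>. Max (range (\<lambda>i. w $ i \<bullet> Z \<omega>)) \<partial>M"
  let ?S = "{w :: 'b ^ 'm. (\<Sum>i\<in>UNIV. p i *\<^sub>R w $ i) = 0}"
  have cont: "continuous_on A ?G" for A
    using shift_mono_expectation_continuous[OF M Z shift_mono_Max]
    by (rule continuous_on_subset) simp
  have pos: "0 < ?G w" if "w \<in> ?S" "w \<noteq> 0" for w
  proof -
    let ?m = "\<lambda>\<omega>. Max (range (\<lambda>i. w $ i \<bullet> Z \<omega>))"
    have int: "integrable M ?m" by (rule shift_mono_integrable[OF M Z shift_mono_Max])
    have le: "w $ i \<bullet> Z \<omega> \<le> ?m \<omega>" for i \<omega> by (intro Max_ge) auto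
    have zero: "(\<Sum>i\<in>UNIV. p i * (w $ i \<bullet> z)) = 0" for z
    proof -
      have "(\<Sum>i\<in>UNIV. p i * (w $ i \<bullet> z)) = (\<Sum>i\<in>UNIV. p i *\<^sub>R w $ i) \<bullet> z"
        by (simp add: inner_sum_left)
      then show ?thesis using that by simp
    qed
    \<comment> \<open>The maximum equals the weighted sum of its gaps to the entries. If it
      vanishes, so do all gaps, and then all entries.\<close>
    have gap: "(\<Sum>i\<in>UNIV. p i * (?m \<omega> - w $ i \<bullet> Z \<omega>)) = ?m \<omega>" for \<omega>
      using zero[of "Z \<omega>"] p(2)
      by (simp add: right_diff_distrib sum_subtractf flip: sum_distrib_right)
    have nn: "0 \<le> p i * (?m \<omega> - w $ i \<bullet> Z \<omega>)" for i \<omega>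
      using le[of i \<omega>] p by (simp add: less_imp_le)
    have m_nn: "0 \<le> ?m \<omega>" for \<omega>
      using sum_nonneg[of UNIV "\<lambda>i. p i * (?m \<omega> - w $ i \<bullet> Z \<omega>)", OF nn] by (simp only: gap)
    show ?thesis
    proof (rule ccontr)
      assume "\<not> 0 < ?G w"
      then have "?G w = 0" using integral_nonneg_AE[of ?m M] m_nn by fastforce
      then have ae: "AE \<omega> in M. ?m \<omega> = 0"
        using integral_nonneg_eq_0_iff_AE[OF int] m_nn by simp
      have "w $ i = 0" for i
      proof (rule nondeg)
        show "AE \<omega> in M. w $ i \<bullet> Z \<omega> = 0"
          using ae
        proof eventually_elim
          case (elim \<omega>)
          then have "(\<Sum>i\<in>UNIV. p i * (?m \<omega> - w $ i \<bullet> Z \<omega>)) = 0" by (rule trans[OF gap])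
          then have "p i * (?m \<omega> - w $ i \<bullet> Z \<omega>) = 0"
            using sum_nonneg_eq_0_iff[of UNIV "\<lambda>i. p i * (?m \<omega> - w $ i \<bullet> Z \<omega>)"] nn by simp
          then show ?case using elim p by (simp add: less_imp_neq[symmetric])
        qed
      qed
      then show False using \<open>w \<noteq> 0\<close> by (simp add: vec_eq_iff)
    qed
  qed
  have closed: "closed ?S"
    by (intro closed_Collect_eq continuous_intros)
  have "compact (?S \<inter> sphere 0 1)"
    using closed by (intro closed_Int_compact) auto
  obtain c where c: "0 < c" "\<And>w. w \<in> ?S \<inter> sphere 0 1 \<Longrightarrow> c \<le> ?G w"
  proof (cases "?S \<inter> sphere 0 1 = {}")
    \<comment> \<open>The subspace is trivial here, as for a single atom, and any positive constant
      works.\<close>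
    case True
    then show ?thesis using that[of 1] by auto
  next
    case False
    from continuous_attains_inf[OF \<open>compact _\<close> this cont] obtain u where
      "u \<in> ?S \<inter> sphere 0 1" "\<forall>w\<in>?S \<inter> sphere 0 1. ?G u \<le> ?G w" by blast
    moreover from this have "u \<noteq> 0" by auto
    ultimately show ?thesis using that[of "?G u"] pos[of u] by auto
  qed
  show ?thesis
  proof (rule that[OF c(1)])
    fix w :: "'b ^ 'm" assume w: "(\<Sum>i\<in>UNIV. p i *\<^sub>R w $ i) = 0"
    show "c * norm w \<le> ?G w"
    proof (cases "w = 0")
      case False
      let ?u = "w /\<^sub>R norm w"
      have "(\<Sum>i\<in>UNIV. p i *\<^sub>R ?u $ i) = (\<Sum>i\<in>UNIV. p i *\<^sub>R w $ i) /\<^sub>R norm w"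
        by (simp add: scaleR_sum_right mult.commute)
      then have "c \<le> ?G ?u" using w False by (intro c(2)) auto
      \<comment> \<open>Positive homogeneity carries the bound from the sphere to the whole
        subspace.\<close>
      also have "?G ?u = (\<integral>\<omega>. Max (range (\<lambda>i. w $ i \<bullet> Z \<omega>)) / norm w \<partial>M)"
      proof (rule Bochner_Integration.integral_cong[OF refl])
        fix \<omega>
        have "mono (\<lambda>t. t / norm w)" by (auto intro!: monoI divide_right_mono)
        from mono_Max_commute[OF this, of "range (\<lambda>i. w $ i \<bullet> Z \<omega>)"]
        show "Max (range (\<lambda>i. ?u $ i \<bullet> Z \<omega>)) = Max (range (\<lambda>i. w $ i \<bullet> Z \<omega>)) / norm w"
          by (simp add: image_image field_simps)
      qed
      finally show ?thesis using False by (simp add: field_simps)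
    qed simp
  qed
qed

text \<open>The prescribed moments are the points \<open>z i\<close> contracted towards the mean of
  \<open>Z\<close>. By \<open>dom\<close> the linear term then costs at most the fraction 1 -
  \<epsilon> of the expected maximum, and what remains grows linearly in
  \<open>norm w\<close>.\<close>

theorem exists_gibbs_weights:
  fixes Z :: "'s \<Rightarrow> 'b::euclidean_space" and p :: "'m::finite \<Rightarrow> real"
  assumes M: "prob_space M" and Z: "integrable M Z"
    and nondeg: "\<And>v. (AE \<omega> in M. v \<bullet> Z \<omega> = 0) \<Longrightarrow> v = 0"
    and p: "\<forall>i. 0 < p i" "(\<Sum>i\<in>UNIV. p i) = 1"
    and \<epsilon>: "0 < \<epsilon>" "\<epsilon> < 1"
    and mean: "(\<Sum>i\<in>UNIV. p i *\<^sub>R z i) = (\<integral>\<omega>. Z \<omega> \<partial>M)"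
    and dom: "\<And>w :: 'b ^ 'm. (\<Sum>i\<in>UNIV. p i * (w $ i \<bullet> z i)) \<le> (\<integral>\<omega>. Max (range (\<lambda>i. w $ i \<bullet> Z \<omega>)) \<partial>M)"
  obtains w :: "'b ^ 'm" where
    "\<And>i. (\<integral>\<omega>. (exp (w $ i \<bullet> Z \<omega>) / (\<Sum>j\<in>UNIV. p j * exp (w $ j \<bullet> Z \<omega>))) *\<^sub>R Z \<omega> \<partial>M)
        = (1 - \<epsilon>) *\<^sub>R z i + \<epsilon> *\<^sub>R (\<integral>\<omega>. Z \<omega> \<partial>M)"
proof -
  interpret prob_space M by fact
  note h = shift_mono_lse[OF p(1)]
  let ?E = "\<integral>\<omega>. Z \<omega> \<partial>M"
  let ?y = "\<lambda>i. (1 - \<epsilon>) *\<^sub>R z i + \<epsilon> *\<^sub>R ?E"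
  let ?B = "\<lambda>w :: 'b ^ 'm. \<integral>\<omega>. lse p (\<lambda>i. w $ i \<bullet> Z \<omega>) \<partial>M"
  let ?G = "\<lambda>w :: 'b ^ 'm. \<integral>\<omega>. Max (range (\<lambda>i. w $ i \<bullet> Z \<omega>)) \<partial>M"
  define \<Phi> where "\<Phi> w = ?B w - (\<Sum>i\<in>UNIV. p i * (w $ i \<bullet> ?y i))" for w
  let ?S = "{w :: 'b ^ 'm. (\<Sum>i\<in>UNIV. p i *\<^sub>R w $ i) = 0}"
  obtain c where c: "0 < c" "\<And>w. w \<in> ?S \<Longrightarrow> c * norm w \<le> ?G w"
    by (rule Max_expectation_coercive[OF M Z nondeg p]) auto
  \<comment> \<open>The constant lost when log-sum-exp is replaced by the maximum.\<close>
  define l where "l = Min (range (\<lambda>i. ln (p i)))"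
  have l: "l \<le> ln (p i)" for i unfolding l_def by (intro Min_le) auto
  have "?G w + l \<le> ?B w" for w
  proof -
    have "Max (range (\<lambda>i. w $ i \<bullet> Z \<omega>)) \<le> lse p (\<lambda>i. w $ i \<bullet> Z \<omega>) - l" for \<omega>
    proof -
      have "w $ i \<bullet> Z \<omega> \<le> lse p (\<lambda>i. w $ i \<bullet> Z \<omega>) - l" for i
        using lse_ge[OF p(1), of "\<lambda>i. w $ i \<bullet> Z \<omega>" i] l[of i] by linarith
      then show ?thesis by simp
    qed
    then have "?G w \<le> (\<integral>\<omega>. lse p (\<lambda>i. w $ i \<bullet> Z \<omega>) - l \<partial>M)"
      by (intro integral_mono Bochner_Integration.integrable_diff integrable_const
            shift_mono_integrable[OF M Z] h shift_mono_Max)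
    also have "\<dots> = ?B w - l"
      using shift_mono_integrable[OF M Z h, of w] by (simp add: prob_space)
    finally show ?thesis by simp
  qed
  note B_ge = this
  have lower: "\<epsilon> * c * norm w + l \<le> \<Phi> w" if "w \<in> ?S" for w
  proof -
    \<comment> \<open>The mean part of the targets meets the weighted sum of the blocks of
      \<open>w\<close>, which is 0 on \<open>?S\<close>.\<close>
    have "(\<Sum>i\<in>UNIV. p i * (w $ i \<bullet> ?y i)) =
        (1 - \<epsilon>) * (\<Sum>i\<in>UNIV. p i * (w $ i \<bullet> z i)) + \<epsilon> * ((\<Sum>i\<in>UNIV. p i *\<^sub>R w $ i) \<bullet> ?E)"
      unfolding inner_sum_left sum_distrib_left sum.distrib[symmetric]
      by (intro sum.cong refl) (simp add: inner_add_right algebra_simps)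
    also have "\<dots> \<le> (1 - \<epsilon>) * ?G w"
      using that dom[of w] \<epsilon> by simp
    finally have "\<epsilon> * ?G w + l \<le> \<Phi> w"
      using B_ge[of w] by (simp add: \<Phi>_def algebra_simps)
    moreover have "\<epsilon> * (c * norm w) \<le> \<epsilon> * ?G w"
      using c(2)[OF that] \<epsilon> by simp
    ultimately show ?thesis by (simp add: mult.assoc)
  qed
  have cont: "continuous_on A \<Phi>" for A
    unfolding \<Phi>_def
    by (intro continuous_intros continuous_on_subset[OF shift_mono_expectation_continuous[OF M Z h]]) simp
  have \<Phi>0: "\<Phi> 0 = 0" using p(2) by (simp add: \<Phi>_def lse_def)
  \<comment> \<open>From this radius on, linear growth outweighs \<open>l\<close>, so \<Phi> is at
    least \<open>\<Phi> 0 = 0\<close>. A minimizer on the ball is therefore a minimizer on all of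
    \<open>?S\<close>.\<close>
  define R where "R = \<bar>l\<bar> / (\<epsilon> * c) + 1"
  have out: "0 \<le> \<Phi> w" if "w \<in> ?S" "R \<le> norm w" for w
  proof -
    have "\<bar>l\<bar> \<le> \<epsilon> * c * R" using \<epsilon> c by (simp add: R_def field_simps)
    also have "\<dots> \<le> \<epsilon> * c * norm w" using that \<epsilon> c by simp
    finally show ?thesis using lower[OF that(1)] by linarith
  qed
  have R: "0 \<le> R" using \<epsilon> c by (simp add: R_def)
  have closed: "closed ?S"
    by (intro closed_Collect_eq continuous_intros)
  have "compact (?S \<inter> cball 0 R)" using closed by (intro closed_Int_compact) auto
  moreover have z_in: "0 \<in> ?S \<inter> cball 0 R" using R by simp
  ultimately obtain w where w: "w \<in> ?S \<inter> cball 0 R" "\<And>w'. w' \<in> ?S \<inter> cball 0 R \<Longrightarrow> \<Phi> w \<le> \<Phi> w'"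
    using continuous_attains_inf[OF _ _ cont, of "?S \<inter> cball 0 R"] by blast
  have min_S: "\<Phi> w \<le> \<Phi> w'" if "w' \<in> ?S" for w'
  proof (cases "norm w' \<le> R")
    case True then show ?thesis using w(2) that by simp
  next
    case False then show ?thesis using w(2)[OF z_in] \<Phi>0 out[OF that] by simp
  qed
  \<comment> \<open>\<open>\<Phi>\<close> is invariant under adding one vector to all \<open>w $ i\<close>, so a minimizer on \<open>?S\<close> is global.\<close>
  have "\<Phi> w \<le> \<Phi> w'" for w'
  proof -
    define v where "v = (\<Sum>i\<in>UNIV. p i *\<^sub>R w' $ i)"
    let ?u = "\<chi> i. w' $ i - v"
    have "?u \<in> ?S"
      using p(2) by (simp add: scaleR_diff_right sum_subtractf v_def flip: scaleR_sum_left)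
    moreover have "\<Phi> ?u = \<Phi> w'"
    proof -
      have "lse p (\<lambda>i. ?u $ i \<bullet> Z \<omega>) = lse p (\<lambda>i. w' $ i \<bullet> Z \<omega>) - v \<bullet> Z \<omega>" for \<omega>
      proof (rule antisym)
        show "lse p (\<lambda>i. ?u $ i \<bullet> Z \<omega>) \<le> lse p (\<lambda>i. w' $ i \<bullet> Z \<omega>) - v \<bullet> Z \<omega>"
          using shift_monoD[OF h, of "\<lambda>i. ?u $ i \<bullet> Z \<omega>" "\<lambda>i. w' $ i \<bullet> Z \<omega>" "- (v \<bullet> Z \<omega>)"]
          by (simp add: inner_diff_left)
        show "lse p (\<lambda>i. w' $ i \<bullet> Z \<omega>) - v \<bullet> Z \<omega> \<le> lse p (\<lambda>i. ?u $ i \<bullet> Z \<omega>)"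
          using shift_monoD[OF h, of "\<lambda>i. w' $ i \<bullet> Z \<omega>" "\<lambda>i. ?u $ i \<bullet> Z \<omega>" "v \<bullet> Z \<omega>"]
          by (simp add: inner_diff_left)
      qed
      then have "?B ?u = ?B w' - v \<bullet> ?E"
        using shift_mono_integrable[OF M Z h, of w'] Z by simp
      moreover have "(\<Sum>i\<in>UNIV. p i * (w' $ i \<bullet> ?y i)) - v \<bullet> ?E = (\<Sum>i\<in>UNIV. p i * (?u $ i \<bullet> ?y i))"
      proof -
        \<comment> \<open>The targets average to the mean of \<open>Z\<close>; hence a common shift
          \<open>v\<close> changes both parts of \<Phi> by \<open>v \<bullet> ?E\<close>, and the
          changes cancel.\<close>
        have "(\<Sum>i\<in>UNIV. p i *\<^sub>R ?y i) = ?E"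
        proof -
          have "(\<Sum>i\<in>UNIV. p i *\<^sub>R ?y i) = (1 - \<epsilon>) *\<^sub>R (\<Sum>i\<in>UNIV. p i *\<^sub>R z i) + \<epsilon> *\<^sub>R ((\<Sum>i\<in>UNIV. p i) *\<^sub>R ?E)"
            by (simp add: scaleR_add_right sum.distrib scaleR_sum_right scaleR_sum_left mult.commute)
          also have "\<dots> = ?E" by (simp add: mean p(2) flip: scaleR_add_left)
          finally show ?thesis .
        qed
        moreover have "(\<Sum>i\<in>UNIV. p i * (v \<bullet> ?y i)) = v \<bullet> (\<Sum>i\<in>UNIV. p i *\<^sub>R ?y i)"
          by (simp add: inner_sum_right)
        ultimately have "(\<Sum>i\<in>UNIV. p i * (v \<bullet> ?y i)) = v \<bullet> ?E" by (simp only:)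
        then show ?thesis
          by (simp add: inner_diff_left right_diff_distrib sum_subtractf)
      qed
      ultimately show ?thesis by (simp add: \<Phi>_def)
    qed
    ultimately show ?thesis using min_S[of ?u] by simp
  qed
  then show ?thesis
    by (intro that lse_minimizer_critical[OF M Z p(1)]) (simp add: \<Phi>_def)
qed

section \<open>Convex functions and log-concavity\<close>

text \<open>Separate the epigraph from the open vertical ray below \<open>(x, g x)\<close>. The ray
  fixes the sign of the last coordinate of the normal, and finiteness of \<open>g\<close> on the
  whole space rules out a vertical hyperplane.\<close>

lemma convex_affine_minorant:
  fixes g :: "'a::euclidean_space \<Rightarrow> real"
  assumes g: "convex_on UNIV g"
  obtains v where "\<And>y. g x + v \<bullet> (y - x) \<le> g y"
proof -
  let ?T = "{x} \<times> {..<g x}"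
  have "convex (epigraph UNIV g)" using g by (rule convex_epigraphI)
  moreover have "convex ?T" by (intro convex_Times) auto
  moreover have "?T \<noteq> {}" by (auto intro: lt_ex)
  moreover have "(x, g x) \<in> epigraph UNIV g" by (simp add: mem_epigraph)
  moreover have "?T \<inter> epigraph UNIV g = {}" by (auto simp: mem_epigraph)
  ultimately obtain n b where n: "n \<noteq> 0" "\<forall>z\<in>?T. n \<bullet> z \<le> b" "\<forall>z\<in>epigraph UNIV g. b \<le> n \<bullet> z"
    using separating_hyperplane_sets[of ?T "epigraph UNIV g"] by blast
  obtain a \<alpha> where n_eq: "n = (a, \<alpha>)" by (cases n)
  have below: "a \<bullet> x + \<alpha> * s \<le> b" if "s < g x" for s
    using n(2) that by (auto simp: n_eq)
  have above: "b \<le> a \<bullet> y + \<alpha> * t" if "g y \<le> t" for y t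
  proof -
    have "(y, t) \<in> epigraph UNIV g" using that by (simp add: mem_epigraph)
    with n(3) show ?thesis unfolding n_eq by force
  qed
  have "0 \<le> \<alpha>"
    using below[of "g x - 1"] above[of x "g x"] by (simp add: algebra_simps)
  moreover have "\<alpha> \<noteq> 0"
  \<comment> \<open>A vertical hyperplane with normal \<open>a\<close> would leave the point of the
    epigraph above \<open>x - a\<close> on the wrong side unless \<open>a = 0\<close>.\<close>
  proof
    assume "\<alpha> = 0"
    then have "a \<bullet> x \<le> a \<bullet> (x - a)"
      using below[of "g x - 1"] above[of "x - a" "g (x - a)"] by simp
    then have "a = 0" by (simp add: inner_diff_right) (meson inner_gt_zero_iff not_le)
    then show False using n(1) \<open>\<alpha> = 0\<close> by (simp add: n_eq zero_prod_def)
  qed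
  ultimately have \<alpha>: "0 < \<alpha>" by simp
  \<comment> \<open>The ray does not contain its endpoint; the slack \<open>e / \<alpha>\<close>
    approaches it from below.\<close>
  have "a \<bullet> x + \<alpha> * g x \<le> b"
  proof (rule field_le_epsilon)
    fix e :: real assume "0 < e"
    then show "a \<bullet> x + \<alpha> * g x \<le> b + e"
      using below[of "g x - e / \<alpha>"] \<alpha> by (simp add: algebra_simps)
  qed
  then have *: "a \<bullet> x + \<alpha> * g x \<le> a \<bullet> y + \<alpha> * g y" for y
    using above[of y "g y"] by simp
  show ?thesis
  proof (rule that)
    fix y
    show "g x + (- a /\<^sub>R \<alpha>) \<bullet> (y - x) \<le> g y"
      using *[of y] \<alpha> by (simp add: inner_diff_right field_simps)
  qed
qed

text \<open>Minus the logarithm of a Gibbs weight is the log-sum-exp of affine functions minus one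
  of them, hence convex and finite everywhere. Its gradient is the Gibbs average of the
  \<open>V j\<close> minus \<open>V i\<close>, a quotient of smooth functions.\<close>

lemma gibbs_log_concave:
  fixes V :: "'m::finite \<Rightarrow> 'a::euclidean_space"
  assumes p: "\<forall>i. 0 < p i" and f: "\<And>y. f y = gibbs_tuple p U V i y"
  shows "log_concave f"
proof -
  let ?a = "\<lambda>y j. U j + V j \<bullet> y"
  let ?S = "\<lambda>y. \<Sum>j\<in>UNIV. p j * exp (?a y j)"
  define g where "g y = lse p (?a y) - ?a y i" for y
  have S: "0 < ?S y" for y by (rule weighted_exp_sum_pos[OF p])
  have f_eq: "f y = exp (- g y)" for y
    by (simp add: f gibbs_tuple_def g_def exp_diff exp_lse[OF p])
  have conv: "g (u *\<^sub>R y + v *\<^sub>R z) \<le> u * g y + v * g z" if uv: "0 \<le> u" "0 \<le> v" "u + v = 1" for u v y z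
  proof -
    have aff: "?a (u *\<^sub>R y + v *\<^sub>R z) j = u * ?a y j + v * ?a z j" for j
    proof -
      have "U j = u * U j + v * U j" using uv by (simp flip: distrib_right)
      then show ?thesis by (simp add: inner_add_right algebra_simps)
    qed
    have "lse p (?a (u *\<^sub>R y + v *\<^sub>R z)) \<le> u * lse p (?a y) + v * lse p (?a z)"
      unfolding aff by (rule lse_convex[OF p uv])
    then show ?thesis unfolding g_def aff by (simp add: algebra_simps)
  qed
  define G where "G y = (\<Sum>j\<in>UNIV. (p j * exp (?a y j)) *\<^sub>R V j) /\<^sub>R ?S y - V i" for y
  have grad: "GDERIV g y :> G y" for y
  proof -
    have "((\<lambda>y. ?S y) has_derivative (\<lambda>h. \<Sum>j\<in>UNIV. p j * (exp (?a y j) * (V j \<bullet> h)))) (at y)"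
      by (auto intro!: derivative_eq_intros simp: mult.commute)
    from has_derivative_ln[OF S this]
    have "((\<lambda>y. ln (?S y)) has_derivative (\<lambda>h. (\<Sum>j\<in>UNIV. p j * (exp (?a y j) * (V j \<bullet> h))) * inverse (?S y))) (at y)" .
    moreover have "((\<lambda>y. ?a y i) has_derivative (\<lambda>h. V i \<bullet> h)) (at y)"
      by (auto intro!: derivative_eq_intros)
    ultimately have "(g has_derivative (\<lambda>h. (\<Sum>j\<in>UNIV. p j * (exp (?a y j) * (V j \<bullet> h))) * inverse (?S y) - V i \<bullet> h)) (at y)"
      unfolding g_def lse_def by (rule has_derivative_diff)
    then show ?thesis
      unfolding gderiv_def
      by (rule has_derivative_eq_rhs)
        (auto simp: G_def inner_diff_right inner_sum_right inner_commute mult_ac fun_eq_iff)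
  qed
  have diff: "G differentiable (at y)" for y
  proof -
    have "((\<lambda>y. exp (?a y j)) has_derivative (\<lambda>h. exp (?a y j) * (V j \<bullet> h))) (at y)" for j
      by (auto intro!: derivative_eq_intros)
    then have e: "(\<lambda>y. exp (?a y j)) differentiable (at y)" for j
      by (auto simp: differentiable_def)
    have "(\<lambda>y. \<Sum>j\<in>UNIV. (p j * exp (?a y j)) *\<^sub>R V j) differentiable (at y)"
      by (intro differentiable_sum differentiable_scaleR differentiable_mult differentiable_const e ballI finite)
    moreover have "(\<lambda>y. inverse (?S y)) differentiable (at y)"
      by (intro differentiable_inverse differentiable_sum differentiable_mult differentiable_const e ballI finite)
        (use S[of y] in simp)
    ultimately show ?thesis
      unfolding G_def by (intro differentiable_diff differentiable_scaleR differentiable_const)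
  qed
  show ?thesis
    unfolding log_concave_def
  proof (intro exI conjI)
    show "\<forall>x. ereal (g x) \<noteq> - \<infinity>" by simp
    show "ereal_convex (\<lambda>x. ereal (g x))"
      using conv by (simp add: ereal_convex_def)
    show "twice_differentiable_on_open (\<lambda>x. real_of_ereal (ereal (g x))) (interior {x. ereal (g x) < \<infinity>})"
      using grad diff by (auto simp: twice_differentiable_on_open_def)
    show "\<forall>x. f x = (if ereal (g x) = \<infinity> then 0 else exp (- real_of_ereal (ereal (g x))))"
      by (simp add: f_eq)
  qed
qed

section \<open>Expectations in the extended reals\<close>

lemma ext_expectation_integrable:
  assumes "integrable M g"
  shows "ext_expectation M g = ereal (\<integral>\<omega>. g \<omega> \<partial>M)"
proof -
  have "(\<integral>\<^sup>+ \<omega>. ennreal (g \<omega>) \<partial>M) \<noteq> \<infinity>" "(\<integral>\<^sup>+ \<omega>. ennreal (- g \<omega>) \<partial>M) \<noteq> \<infinity>"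
    using assms by (auto simp: real_integrable_def)
  then show ?thesis
    unfolding ext_expectation_def real_lebesgue_integral_def[OF assms]
    by (cases "\<integral>\<^sup>+ \<omega>. ennreal (g \<omega>) \<partial>M" rule: ennreal_cases;
        cases "\<integral>\<^sup>+ \<omega>. ennreal (- g \<omega>) \<partial>M" rule: ennreal_cases) auto
qed

text \<open>A convex function of \<open>Y\<close> may have infinite expectation, so positive and
  negative parts are compared separately rather than through Bochner integrals.\<close>

lemma ext_expectation_mono_AE:
  assumes "AE \<omega> in M. f \<omega> \<le> g \<omega>"
  shows "ext_expectation M f \<le> ext_expectation M g"
proof -
  have "(\<integral>\<^sup>+ \<omega>. ennreal (f \<omega>) \<partial>M) \<le> (\<integral>\<^sup>+ \<omega>. ennreal (g \<omega>) \<partial>M)"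
    using assms by (intro nn_integral_mono_AE) (auto intro: ennreal_leI)
  moreover have "(\<integral>\<^sup>+ \<omega>. ennreal (- g \<omega>) \<partial>M) \<le> (\<integral>\<^sup>+ \<omega>. ennreal (- f \<omega>) \<partial>M)"
  proof (rule nn_integral_mono_AE)
    show "AE \<omega> in M. ennreal (- g \<omega>) \<le> ennreal (- f \<omega>)"
      using assms by eventually_elim (simp add: ennreal_leI)
  qed
  ultimately show ?thesis
    unfolding ext_expectation_def by (intro ereal_minus_mono) (simp_all flip: less_eq_ennreal.rep_eq)
qed

section \<open>Perturbing positive weights\<close>

text \<open>Strict positivity leaves room to change every weight in both directions, and the moment
  map of suitable small changes is onto. Any prescribed shifts \<open>d i\<close> compatible with
  the partition of unity can thus be realized up to a common factor \<delta>.\<close>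

lemma perturb_weights:
  fixes Z :: "'s \<Rightarrow> 'b::euclidean_space" and p :: "'m::finite \<Rightarrow> real"
  assumes Z[measurable]: "Z \<in> borel_measurable M"
    and nondeg: "\<And>v. (AE \<omega> in M. v \<bullet> Z \<omega> = 0) \<Longrightarrow> v = 0"
    and f[measurable]: "\<And>i. f i \<in> borel_measurable M" and f_pos: "\<And>i \<omega>. 0 < f i \<omega>"
    and f_sum: "\<And>\<omega>. (\<Sum>i\<in>UNIV. p i * f i \<omega>) = 1"
    and int: "\<And>i. integrable M (\<lambda>\<omega>. f i \<omega> *\<^sub>R Z \<omega>)"
    and d: "(\<Sum>i\<in>UNIV. p i *\<^sub>R d i) = 0"
  obtains \<delta> h where "0 < \<delta>" "\<And>i. h i \<in> borel_measurable M" "\<And>i \<omega>. 0 \<le> h i \<omega>"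
    "\<And>\<omega>. (\<Sum>i\<in>UNIV. p i * h i \<omega>) = 1"
    "\<And>i. has_bochner_integral M (\<lambda>\<omega>. h i \<omega> *\<^sub>R Z \<omega>) ((\<integral>\<omega>. f i \<omega> *\<^sub>R Z \<omega> \<partial>M) + \<delta> *\<^sub>R d i)"
proof -
  \<comment> \<open>A positive measurable function lying below every \<open>f i\<close>.\<close>
  define m where "m \<omega> = inverse (\<Sum>i\<in>UNIV. inverse (f i \<omega>))" for \<omega>
  have [measurable]: "m \<in> borel_measurable M" unfolding m_def[abs_def] by measurable
  have sum_pos: "0 < (\<Sum>i\<in>UNIV. inverse (f i \<omega>))" for \<omega>
    using f_pos by (intro sum_pos) auto
  have m_pos: "0 < m \<omega>" for \<omega> using sum_pos[of \<omega>] by (simp add: m_def)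
  have m_le: "m \<omega> \<le> f i \<omega>" for i \<omega>
  proof -
    have "inverse (f i \<omega>) \<le> (\<Sum>i\<in>UNIV. inverse (f i \<omega>))"
      using f_pos by (intro member_le_sum) (auto simp: less_imp_le)
    then have "inverse (\<Sum>i\<in>UNIV. inverse (f i \<omega>)) \<le> inverse (inverse (f i \<omega>))"
      using f_pos by (intro le_imp_inverse_le) auto
    then show ?thesis by (simp add: m_def)
  qed
  \<comment> \<open>The weight \<open>W\<close> keeps \<open>\<bar>W (v \<bullet> Z)\<bar> \<le> norm v * f i\<close> for every \<open>i\<close>. The moment map \<open>T\<close> of these
    perturbations is a weighted Gram operator, hence bijective by nondegeneracy.\<close>
  define W where "W \<omega> = m \<omega> / (1 + norm (Z \<omega>))" for \<omega>
  have [measurable]: "W \<in> borel_measurable M" unfolding W_def[abs_def] by measurable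
  have den: "0 < 1 + norm (Z \<omega>)" for \<omega> by (simp add: add_pos_nonneg)
  have W_pos: "0 < W \<omega>" for \<omega> using m_pos den by (simp add: W_def)
  have W_le: "\<bar>W \<omega> * (v \<bullet> Z \<omega>)\<bar> \<le> norm v * f i \<omega>" for v \<omega> i
  proof -
    have "W \<omega> * norm (Z \<omega>) \<le> m \<omega>"
      using den[of \<omega>] m_pos[of \<omega>] by (simp add: W_def field_simps)
    have "\<bar>W \<omega> * (v \<bullet> Z \<omega>)\<bar> = W \<omega> * \<bar>v \<bullet> Z \<omega>\<bar>"
      using W_pos[of \<omega>] by (simp add: abs_mult)
    also have "\<dots> \<le> W \<omega> * (norm v * norm (Z \<omega>))"
      using W_pos[of \<omega>] by (intro mult_left_mono Cauchy_Schwarz_ineq2) simp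
    also have "\<dots> = norm v * (W \<omega> * norm (Z \<omega>))" by simp
    also have "\<dots> \<le> norm v * f i \<omega>"
      using \<open>W \<omega> * norm (Z \<omega>) \<le> m \<omega>\<close> m_le[of \<omega> i] by (intro mult_left_mono) auto
    finally show ?thesis .
  qed
  have int_W: "integrable M (\<lambda>\<omega>. (W \<omega> * (v \<bullet> Z \<omega>)) *\<^sub>R Z \<omega>)" for v
  proof (rule Bochner_Integration.integrable_bound)
    \<comment> \<open>Any index provides a majorant; the index type is nonempty.\<close>
    fix i :: 'm
    show "integrable M (\<lambda>\<omega>. norm v *\<^sub>R (f i \<omega> *\<^sub>R Z \<omega>))" by (intro integrable_scaleR_right int)
    show "AE \<omega> in M. norm ((W \<omega> * (v \<bullet> Z \<omega>)) *\<^sub>R Z \<omega>) \<le> norm (norm v *\<^sub>R (f i \<omega> *\<^sub>R Z \<omega>))"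
    proof (rule AE_I2)
      fix \<omega>
      have "\<bar>W \<omega> * (v \<bullet> Z \<omega>)\<bar> * norm (Z \<omega>) \<le> (norm v * f i \<omega>) * norm (Z \<omega>)"
        by (intro mult_right_mono W_le) simp
      then show "norm ((W \<omega> * (v \<bullet> Z \<omega>)) *\<^sub>R Z \<omega>) \<le> norm (norm v *\<^sub>R (f i \<omega> *\<^sub>R Z \<omega>))"
        using f_pos[of i \<omega>] by (simp only: norm_scaleR) (simp add: mult.assoc)
    qed
  qed measurable
  define T where "T v = (\<integral>\<omega>. (W \<omega> * (v \<bullet> Z \<omega>)) *\<^sub>R Z \<omega> \<partial>M)" for v
  have lin: "linear T"
  proof (rule linearI)
    show "T (u + v) = T u + T v" for u v
      using int_W[of u] int_W[of v] by (simp add: T_def inner_add_left distrib_left scaleR_add_left)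
    show "T (c *\<^sub>R v) = c *\<^sub>R T v" for c v
    proof -
      have "T (c *\<^sub>R v) = (\<integral>\<omega>. c *\<^sub>R ((W \<omega> * (v \<bullet> Z \<omega>)) *\<^sub>R Z \<omega>) \<partial>M)"
        by (simp add: T_def mult.left_commute)
      also have "\<dots> = c *\<^sub>R T v" unfolding T_def by (rule integral_scaleR_right)
      finally show ?thesis .
    qed
  qed
  have "inj T"
    unfolding linear_injective_0[OF lin]
  proof safe
    \<comment> \<open>Pairing \<open>T v\<close> with \<open>v\<close> gives the expectation of
      \<open>W \<omega> * (v \<bullet> Z \<omega>)\<^sup>2\<close>, which is nonnegative; since
      \<open>W\<close> is positive it vanishes only if \<open>v \<bullet> Z\<close> is 0 almost
      everywhere.\<close>
    fix v assume "T v = 0"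
    have int_v: "integrable M (\<lambda>\<omega>. W \<omega> * (v \<bullet> Z \<omega>)\<^sup>2)"
      using integrable_inner_right[of v M, OF int_W[of v]] by (simp add: power2_eq_square mult.assoc)
    have "(\<integral>\<omega>. W \<omega> * (v \<bullet> Z \<omega>)\<^sup>2 \<partial>M) = v \<bullet> T v"
      unfolding T_def using integral_inner_right[of v M, OF int_W[of v]]
      by (simp add: power2_eq_square mult.assoc)
    then have "(\<integral>\<omega>. W \<omega> * (v \<bullet> Z \<omega>)\<^sup>2 \<partial>M) = 0" using \<open>T v = 0\<close> by simp
    then have "AE \<omega> in M. W \<omega> * (v \<bullet> Z \<omega>)\<^sup>2 = 0"
      using W_pos by (subst (asm) integral_nonneg_eq_0_iff_AE[OF int_v]) (auto simp: less_imp_le)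
    then have "AE \<omega> in M. v \<bullet> Z \<omega> = 0"
      using W_pos by (simp add: less_imp_neq[symmetric])
    then show "v = 0" by (rule nondeg)
  qed
  then have "surj T" by (rule linear_injective_imp_surjective[OF lin _ refl])
  then have "\<forall>i. \<exists>v. T v = d i" by (metis surjD)
  then obtain v where v: "\<And>i. T (v i) = d i" by metis
  \<comment> \<open>Injectivity transfers the linear relation from the \<open>d i\<close> to the
    \<open>v i\<close>, which is what keeps the perturbed weights summing to 1.\<close>
  have "T (\<Sum>i\<in>UNIV. p i *\<^sub>R v i) = T 0"
    using d by (simp add: linear_sum[OF lin] linear_cmul[OF lin] linear_0[OF lin] v)
  then have v0: "(\<Sum>i\<in>UNIV. p i *\<^sub>R v i) = 0" by (rule injD[OF \<open>inj T\<close>])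
  \<comment> \<open>Small enough that \<open>\<delta> * norm (v i) \<le> 1\<close> for all
    \<open>i\<close> at once; by \<open>W_le\<close> the perturbation then never exceeds
    \<open>f i\<close>.\<close>
  define \<delta> where "\<delta> = inverse (1 + (\<Sum>i\<in>UNIV. norm (v i)))"
  have \<delta>: "0 < \<delta>" by (simp add: \<delta>_def add_pos_nonneg sum_nonneg)
  have \<delta>_le: "\<delta> * norm (v i) \<le> 1" for i
  proof -
    have "norm (v i) \<le> 1 + (\<Sum>i\<in>UNIV. norm (v i))"
      using member_le_sum[of i UNIV "\<lambda>i. norm (v i)"] by simp
    then show ?thesis
      using \<delta> by (simp add: \<delta>_def field_simps)
  qed
  define h where "h i \<omega> = f i \<omega> + \<delta> * (W \<omega> * (v i \<bullet> Z \<omega>))" for i \<omega>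
  show ?thesis
  proof (rule that[OF \<delta>, of h])
    show "h i \<in> borel_measurable M" for i unfolding h_def[abs_def] by measurable
    show "0 \<le> h i \<omega>" for i \<omega>
    proof -
      have "\<bar>\<delta> * (W \<omega> * (v i \<bullet> Z \<omega>))\<bar> = \<delta> * \<bar>W \<omega> * (v i \<bullet> Z \<omega>)\<bar>"
        using \<delta> by (simp add: abs_mult)
      also have "\<dots> \<le> \<delta> * (norm (v i) * f i \<omega>)"
        using \<delta> W_le by (intro mult_left_mono) auto
      also have "\<dots> \<le> f i \<omega>"
        using mult_right_mono[OF \<delta>_le[of i], of "f i \<omega>"] f_pos[of i \<omega>] by (simp add: mult.assoc)
      finally show ?thesis by (simp add: h_def)
    qed
    show "(\<Sum>i\<in>UNIV. p i * h i \<omega>) = 1" for \<omega>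
    proof -
      have "(\<Sum>i\<in>UNIV. p i * h i \<omega>) = (\<Sum>i\<in>UNIV. p i * f i \<omega>) + \<delta> * W \<omega> * ((\<Sum>i\<in>UNIV. p i *\<^sub>R v i) \<bullet> Z \<omega>)"
        unfolding inner_sum_left sum_distrib_left sum.distrib[symmetric]
        by (intro sum.cong refl) (simp add: h_def algebra_simps)
      then show ?thesis by (simp add: f_sum v0)
    qed
    show "has_bochner_integral M (\<lambda>\<omega>. h i \<omega> *\<^sub>R Z \<omega>) ((\<integral>\<omega>. f i \<omega> *\<^sub>R Z \<omega> \<partial>M) + \<delta> *\<^sub>R d i)" for i
    proof -
      have "has_bochner_integral M (\<lambda>\<omega>. f i \<omega> *\<^sub>R Z \<omega> + \<delta> *\<^sub>R ((W \<omega> * (v i \<bullet> Z \<omega>)) *\<^sub>R Z \<omega>))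
          ((\<integral>\<omega>. f i \<omega> *\<^sub>R Z \<omega> \<partial>M) + \<delta> *\<^sub>R T (v i))"
        unfolding T_def
        by (intro has_bochner_integral_add has_bochner_integral_scaleR_right has_bochner_integral_integrable int int_W)
      then show ?thesis by (simp add: h_def scaleR_add_left v)
    qed
  qed
qed

text \<open>For nonzero \<open>v = (a, u)\<close> the equation describes an affine hyperplane, or
  the empty set when \<open>u = 0\<close>. Neither is charged by Lebesgue measure, hence neither
  carries a probability measure \<nu> absolutely continuous to it.\<close>

lemma absolutely_continuous_nondegenerate:
  fixes \<nu> :: "'a::euclidean_space measure" and v :: "real \<times> 'a"
  assumes \<nu>: "prob_space \<nu>" and ac: "absolutely_continuous lborel \<nu>"
    and ae: "AE y in \<nu>. v \<bullet> (1, y) = 0"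
  shows "v = 0"
proof (rule ccontr)
  interpret prob_space \<nu> by fact
  assume "v \<noteq> 0"
  obtain a u where v: "v = (a, u)" by (cases v)
  let ?S = "{y. u \<bullet> y = - a}"
  have "negligible ?S"
    using \<open>v \<noteq> 0\<close> by (intro negligible_hyperplane) (auto simp: v zero_prod_def)
  \<comment> \<open>Negligibility concerns the completed measure; closedness makes the set
    Borel.\<close>
  then have "?S \<in> null_sets lborel"
    by (simp add: negligible_iff_null_sets null_sets_completion_iff closed_hyperplane)
  then have "?S \<in> null_sets \<nu>"
    using ac by (auto simp: absolutely_continuous_def)
  then have "AE y in \<nu>. y \<notin> ?S" by (rule AE_not_in)
  with ae have "AE y in \<nu>. False"
    by eventually_elim (simp add: v)
  then show False by simp
qed

section \<open>Couplings with a finitely supported law\<close>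

lemma subalgebra_vimage_algebra:
  assumes "Y \<in> borel_measurable M"
  shows "subalgebra M (vimage_algebra (space M) Y borel)"
  unfolding subalgebra_def using assms
  by (auto simp: sets_vimage_algebra2 measurable_sets)

text \<open>Events of the \<sigma>-algebra generated by \<open>Y\<close> are preimages of Borel
  sets, so testing on indicators of \<open>B\<close> composed with \<open>Y\<close> is
  enough.\<close>

lemma real_cond_exp_vimage_charact:
  assumes M: "prob_space M" and Y[measurable]: "Y \<in> borel_measurable M"
    and f: "integrable M f" and g[measurable]: "g \<in> borel_measurable borel"
    and gY: "integrable M (\<lambda>\<omega>. g (Y \<omega>))"
    and eq: "\<And>B. B \<in> sets borel \<Longrightarrow>
      (\<integral>\<omega>. indicator B (Y \<omega>) * f \<omega> \<partial>M) = (\<integral>\<omega>. indicator B (Y \<omega>) * g (Y \<omega>) \<partial>M)"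
  shows "AE \<omega> in M. real_cond_exp M (vimage_algebra (space M) Y borel) f \<omega> = g (Y \<omega>)"
proof -
  interpret prob_space M by fact
  interpret F: finite_measure_subalgebra M "vimage_algebra (space M) Y borel"
    by unfold_locales (rule subalgebra_vimage_algebra[OF Y])
  show ?thesis
  proof (rule F.real_cond_exp_charact[OF _ f gY])
    fix A assume "A \<in> sets (vimage_algebra (space M) Y borel)"
    then obtain B where B: "A = Y -` B \<inter> space M" "B \<in> sets borel"
      by (auto simp: sets_vimage_algebra2)
    have "indicator A \<omega> = (indicator B (Y \<omega>) :: real)" if "\<omega> \<in> space M" for \<omega>
      using that by (auto simp: B indicator_def)
    then have "(\<integral>\<omega>. indicator A \<omega> * h \<omega> \<partial>M) = (\<integral>\<omega>. indicator B (Y \<omega>) * h \<omega> \<partial>M)" for h :: "_ \<Rightarrow> real"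
      by (intro Bochner_Integration.integral_cong) auto
    then show "(\<integral>\<omega>\<in>A. f \<omega> \<partial>M) = (\<integral>\<omega>\<in>A. g (Y \<omega>) \<partial>M)"
      using eq[OF B(2)] by (simp add: set_lebesgue_integral_def)
  next
    show "(\<lambda>\<omega>. g (Y \<omega>)) \<in> borel_measurable (vimage_algebra (space M) Y borel)"
      by (rule measurable_compose[OF measurable_vimage_algebra1 g]) simp
  qed
qed

text \<open>\<open>cond_prob_given\<close> is a choice, so a version has to be exhibited: the
  Radon-Nikodym derivative, with respect to the law of \<open>Y\<close>, of the law of
  \<open>Y\<close> restricted to the event \<open>A\<close>.\<close>

lemma cond_prob_given_spec:
  assumes M: "prob_space M" and Y[measurable]: "Y \<in> borel_measurable M" and A[measurable]: "A \<in> sets M"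
  shows "cond_prob_given M A Y \<in> borel_measurable borel"
    "AE \<omega> in M. cond_prob_given M A Y (Y \<omega>) =
       real_cond_exp M (vimage_algebra (space M) Y borel) (indicator A) \<omega>"
proof -
  interpret prob_space M by fact
  let ?\<nu> = "distr M borel Y"
  let ?\<rho> = "distr (density M (indicator A)) borel Y"
  interpret \<nu>: prob_space ?\<nu> by (rule prob_space_distr) fact
  have \<rho>: "emeasure ?\<rho> B = emeasure M (A \<inter> (Y -` B \<inter> space M))" if [measurable]: "B \<in> sets borel" for B
    by (subst emeasure_distr) (auto simp: emeasure_restricted)
  have "finite_measure ?\<rho>"
    by (rule finite_measureI) (use \<rho>[of UNIV] in simp)
  moreover have "absolutely_continuous ?\<nu> ?\<rho>"
    unfolding absolutely_continuous_def
  proof safe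
    fix B assume "B \<in> null_sets ?\<nu>"
    then have [measurable]: "B \<in> sets borel" and "emeasure M (Y -` B \<inter> space M) = 0"
      by (auto simp: null_sets_def emeasure_distr)
    moreover have "emeasure M (A \<inter> (Y -` B \<inter> space M)) \<le> emeasure M (Y -` B \<inter> space M)"
      by (intro emeasure_mono) auto
    ultimately show "B \<in> null_sets ?\<rho>"
      by (auto simp: null_sets_def \<rho>)
  qed
  ultimately obtain D where D: "D \<in> borel_measurable ?\<nu>"
      "AE y in ?\<nu>. RN_deriv ?\<nu> ?\<rho> y = ennreal (D y)" "\<And>y. 0 \<le> D y"
    using \<nu>.real_RN_deriv[of ?\<rho>] by auto
  then have [measurable]: "D \<in> borel_measurable borel" by simp
  have density: "density ?\<nu> D = ?\<rho>"
  proof -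
    have "density ?\<nu> D = density ?\<nu> (RN_deriv ?\<nu> ?\<rho>)"
      using D by (intro density_cong) auto
    also have "\<dots> = ?\<rho>" by (intro \<nu>.density_RN_deriv \<open>absolutely_continuous ?\<nu> ?\<rho>\<close>) simp
    finally show ?thesis .
  qed
  have nn: "(\<integral>\<^sup>+\<omega>. ennreal (indicator B (Y \<omega>) * D (Y \<omega>)) \<partial>M) = emeasure M (A \<inter> (Y -` B \<inter> space M))"
    if [measurable]: "B \<in> sets borel" for B
  proof -
    have "(\<integral>\<^sup>+\<omega>. ennreal (indicator B (Y \<omega>) * D (Y \<omega>)) \<partial>M) = (\<integral>\<^sup>+y. ennreal (D y) * indicator B y \<partial>?\<nu>)"
      by (subst nn_integral_distr) (auto intro!: nn_integral_cong simp: indicator_def)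
    also have "\<dots> = emeasure (density ?\<nu> D) B" by (subst emeasure_density) auto
    finally show ?thesis using \<rho> by (simp add: density)
  qed
  have int: "integrable M (\<lambda>\<omega>. D (Y \<omega>))"
    by (rule integrableI_nonneg) (use nn[of UNIV] D(3) in \<open>auto simp: less_top[symmetric]\<close>)
  have "AE \<omega> in M. real_cond_exp M (vimage_algebra (space M) Y borel) (indicator A) \<omega> = D (Y \<omega>)"
  proof (rule real_cond_exp_vimage_charact[OF M Y _ _ int])
    fix B :: "'b set" assume [measurable]: "B \<in> sets borel"
    have "(\<integral>\<omega>. indicator B (Y \<omega>) * indicator A \<omega> \<partial>M) = ((\<integral>\<omega>. indicator (A \<inter> (Y -` B \<inter> space M)) \<omega> \<partial>M) :: real)"
      by (intro Bochner_Integration.integral_cong) (auto simp: indicator_def)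
    also have "\<dots> = measure M (A \<inter> (Y -` B \<inter> space M))"
      by (subst Bochner_Integration.integral_indicator) (auto simp: Int_absorb1 sets.sets_into_space)
    also have "\<dots> = enn2real (\<integral>\<^sup>+\<omega>. ennreal (indicator B (Y \<omega>) * D (Y \<omega>)) \<partial>M)"
      by (simp add: nn measure_def)
    also have "\<dots> = (\<integral>\<omega>. indicator B (Y \<omega>) * D (Y \<omega>) \<partial>M)"
      by (intro integral_eq_nn_integral[symmetric]) (auto simp: D(3))
    finally show "(\<integral>\<omega>. indicator B (Y \<omega>) * indicator A \<omega> \<partial>M) = (\<integral>\<omega>. indicator B (Y \<omega>) * D (Y \<omega>) \<partial>M)" .
  qed (auto simp: less_top[symmetric])
  then have "\<exists>g. g \<in> borel_measurable borel \<and> (AE \<omega> in M. g (Y \<omega>) =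
       real_cond_exp M (vimage_algebra (space M) Y borel) (indicator A) \<omega>)"
    by (intro exI[of _ D]) (auto elim!: eventually_mono)
  from someI_ex[OF this] show "cond_prob_given M A Y \<in> borel_measurable borel"
    "AE \<omega> in M. cond_prob_given M A Y (Y \<omega>) =
       real_cond_exp M (vimage_algebra (space M) Y borel) (indicator A) \<omega>"
    unfolding cond_prob_given_def by auto
qed

lemma has_bochner_integral_distr_iff:
  fixes g :: "'a \<Rightarrow> 'b::{banach, second_countable_topology}"
  assumes "Y \<in> measurable M N" "g \<in> borel_measurable N"
  shows "has_bochner_integral (distr M N Y) g c \<longleftrightarrow> has_bochner_integral M (\<lambda>\<omega>. g (Y \<omega>)) c"
  using assms by (simp add: has_bochner_integral_iff integrable_distr_eq integral_distr)

text \<open>All conditions are integrals or null-set statements for the law of \<open>Y\<close>;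
  from here on \<nu> with the identity replaces \<open>N\<close> with \<open>Y\<close>.\<close>

lemma admissible_tuples_distr:
  fixes Y :: "'t \<Rightarrow> 'a::euclidean_space" and p :: "'m::finite \<Rightarrow> real"
  assumes [measurable]: "Y \<in> borel_measurable N"
  shows "admissible_tuples N Y p x = admissible_tuples (distr N borel Y) (\<lambda>y. y) p x"
proof -
  have id: "distr (distr N borel Y) borel (\<lambda>y. y) = distr N borel Y"
    by (subst distr_distr) (auto simp: comp_def)
  have hb: "has_bochner_integral N (\<lambda>\<omega>. g (Y \<omega>)) 1 \<and> has_bochner_integral N (\<lambda>\<omega>. g (Y \<omega>) *\<^sub>R Y \<omega>) z \<longleftrightarrow>
      has_bochner_integral (distr N borel Y) g 1 \<and> has_bochner_integral (distr N borel Y) (\<lambda>y. g y *\<^sub>R y) z"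
    if [measurable]: "g \<in> borel_measurable borel" for g z
    by (subst (1 2) has_bochner_integral_distr_iff) auto
  show ?thesis
    unfolding admissible_tuples_def id
    by (rule Collect_cong) (use hb in blast)
qed

section \<open>From couplings with a finitely supported first law to density tuples\<close>

locale finite_source =
  fixes \<mu> \<nu> :: "'a::euclidean_space measure" and p :: "'m::finite \<Rightarrow> real" and x :: "'m \<Rightarrow> 'a"
  assumes inj: "inj x" and p_pos: "\<forall>i. 0 < p i" and p_sum: "(\<Sum>i\<in>UNIV. p i) = 1"
    and sets_\<mu>: "sets \<mu> = sets borel"
    and \<mu>: "\<And>A. A \<in> sets borel \<Longrightarrow>
      emeasure \<mu> A = (\<Sum>i\<in>UNIV. ennreal (p i) * emeasure (return borel (x i)) A)"
    and prob_\<nu>: "prob_space \<nu>" and sets_\<nu> [measurable_cong]: "sets \<nu> = sets borel"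
begin

lemma AE_source:
  assumes M: "prob_space M" and X[measurable]: "X \<in> borel_measurable M" and law: "distr M borel X = \<mu>"
  shows "AE \<omega> in M. X \<omega> \<in> range x"
proof -
  have [measurable]: "range x \<in> sets borel" by (intro borel_closed finite_imp_closed) simp
  have "emeasure \<mu> (- range x) = 0"
    by (subst \<mu>) (auto simp: indicator_def)
  then have "emeasure M (X -` (- range x) \<inter> space M) = 0"
    unfolding law[symmetric] by (subst (asm) emeasure_distr) auto
  then show ?thesis
    by (intro AE_I[where N = "X -` (- range x) \<inter> space M"]) auto
qed

lemma measure_source:
  assumes M: "prob_space M" and X[measurable]: "X \<in> borel_measurable M" and law: "distr M borel X = \<mu>"
  shows "measure M {\<omega> \<in> space M. X \<omega> = x i} = p i"
proof -
  have "emeasure M (X -` {x i} \<inter> space M) = emeasure \<mu> {x i}"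
    unfolding law[symmetric] by (subst emeasure_distr) auto
  also have "\<dots> = (\<Sum>j\<in>UNIV. if j = i then ennreal (p i) else 0)"
    using inj by (subst \<mu>) (auto intro!: sum.cong simp: inj_eq indicator_def)
  also have "\<dots> = ennreal (p i)" by simp
  also have "X -` {x i} \<inter> space M = {\<omega> \<in> space M. X \<omega> = x i}" by auto
  finally show ?thesis using p_pos by (simp add: measure_def less_imp_le)
qed

lemma
  assumes M: "prob_space M" and X[measurable]: "X \<in> borel_measurable M" and Y[measurable]: "Y \<in> borel_measurable M"
    and X_law: "distr M borel X = \<mu>" and Y_law: "distr M borel Y = \<nu>"
  shows coupling_tuple_measurable [measurable]: "coupling_tuple M X Y x i \<in> borel_measurable borel"
    and coupling_tuple_cond_exp: "AE \<omega> in M. p i * coupling_tuple M X Y x i (Y \<omega>) =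
      real_cond_exp M (vimage_algebra (space M) Y borel) (indicator {\<omega> \<in> space M. X \<omega> = x i}) \<omega>"
proof -
  have [measurable]: "{\<omega> \<in> space M. X \<omega> = x i} \<in> sets M" by measurable
  note spec = cond_prob_given_spec[OF M Y this]
  have p: "p i \<noteq> 0" using p_pos by (metis less_irrefl)
  have eq: "coupling_tuple M X Y x i = (\<lambda>y. cond_prob_given M {\<omega> \<in> space M. X \<omega> = x i} Y y / p i)"
    by (simp add: coupling_tuple_def measure_source[OF M X X_law] fun_eq_iff)
  show "coupling_tuple M X Y x i \<in> borel_measurable borel"
    unfolding eq using spec(1) by measurable
  show "AE \<omega> in M. p i * coupling_tuple M X Y x i (Y \<omega>) =
      real_cond_exp M (vimage_algebra (space M) Y borel) (indicator {\<omega> \<in> space M. X \<omega> = x i}) \<omega>"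
    using spec(2) p by (simp add: eq)
qed

lemma coupling_tuple_joint_law:
  assumes M: "prob_space M" and X[measurable]: "X \<in> borel_measurable M" and Y[measurable]: "Y \<in> borel_measurable M"
    and X_law: "distr M borel X = \<mu>" and Y_law: "distr M borel Y = \<nu>" and B[measurable]: "B \<in> sets borel"
  shows "measure M {\<omega> \<in> space M. X \<omega> = x i \<and> Y \<omega> \<in> B} =
    (\<integral>y. indicator B y * (p i * coupling_tuple M X Y x i y) \<partial>\<nu>)"
proof -
  interpret prob_space M by fact
  interpret F: finite_measure_subalgebra M "vimage_algebra (space M) Y borel"
    by unfold_locales (rule subalgebra_vimage_algebra[OF Y])
  have A[measurable]: "{\<omega> \<in> space M. X \<omega> = x i} \<in> sets M" by measurable
  note [measurable] = coupling_tuple_measurable[OF M X Y X_law Y_law]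
  let ?E = "real_cond_exp M (vimage_algebra (space M) Y borel) (indicator {\<omega> \<in> space M. X \<omega> = x i})"
  have "(\<integral>y. indicator B y * (p i * coupling_tuple M X Y x i y) \<partial>\<nu>) =
      (\<integral>\<omega>. indicator B (Y \<omega>) * (p i * coupling_tuple M X Y x i (Y \<omega>)) \<partial>M)"
    unfolding Y_law[symmetric] by (subst integral_distr) auto
  also have "\<dots> = (\<integral>\<omega>. indicator B (Y \<omega>) * ?E \<omega> \<partial>M)"
    by (rule integral_cong_AE) (use coupling_tuple_cond_exp[OF M X Y X_law Y_law, of i] in auto)
  also have "\<dots> = (\<integral>\<omega>. indicator B (Y \<omega>) * indicator {\<omega> \<in> space M. X \<omega> = x i} \<omega> \<partial>M)"
  proof (rule F.real_cond_exp_intg(2))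
    show "integrable M (\<lambda>\<omega>. indicator B (Y \<omega>) * indicator {\<omega> \<in> space M. X \<omega> = x i} \<omega> :: real)"
      by (rule integrable_const_bound[where B = 1]) (auto simp: indicator_def)
    show "(\<lambda>\<omega>. indicator B (Y \<omega>)) \<in> borel_measurable (vimage_algebra (space M) Y borel)"
      by (rule measurable_compose[OF measurable_vimage_algebra1]) auto
  qed auto
  also have "\<dots> = (\<integral>\<omega>. indicator {\<omega> \<in> space M. X \<omega> = x i \<and> Y \<omega> \<in> B} \<omega> \<partial>M)"
    by (intro Bochner_Integration.integral_cong) (auto simp: indicator_def)
  also have "\<dots> = measure M {\<omega> \<in> space M. X \<omega> = x i \<and> Y \<omega> \<in> B}"
    by (subst Bochner_Integration.integral_indicator) (auto intro!: arg_cong[where f = "measure M"])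
  finally show ?thesis by simp
qed

text \<open>Sign, normalization and mass come from positivity, linearity and total expectation of
  conditioning on \<open>Y\<close>. The mean condition uses both \<sigma>-algebras: conditioning on
  \<open>Y\<close> trades \<open>p i * f i (Y)\<close> for the indicator of \<open>X = x i\<close>,
  and on that event conditioning on \<open>X\<close> trades \<open>Y\<close> for
  \<open>x i\<close>.\<close>

lemma coupling_tuple_admissible:
  assumes c: "martingale_coupling M X Y \<mu> \<nu>"
  shows "coupling_tuple M X Y x \<in> admissible_tuples \<nu> (\<lambda>y. y) p x"
proof -
  from c have M: "prob_space M" and X[measurable]: "X \<in> borel_measurable M"
    and Y[measurable]: "Y \<in> borel_measurable M"
    and X_law: "distr M borel X = \<mu>" and Y_law: "distr M borel Y = \<nu>" and int: "integrable M Y"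
    and mart: "\<And>b. b \<in> Basis \<Longrightarrow>
      AE \<omega> in M. real_cond_exp M (vimage_algebra (space M) X borel) (\<lambda>\<omega>. Y \<omega> \<bullet> b) \<omega> = X \<omega> \<bullet> b"
    by (auto simp: martingale_coupling_def)
  interpret prob_space M by fact
  interpret F: finite_measure_subalgebra M "vimage_algebra (space M) Y borel"
    by unfold_locales (rule subalgebra_vimage_algebra[OF Y])
  interpret G: finite_measure_subalgebra M "vimage_algebra (space M) X borel"
    by unfold_locales (rule subalgebra_vimage_algebra[OF X])
  let ?f = "coupling_tuple M X Y x"
  let ?A = "\<lambda>i. {\<omega> \<in> space M. X \<omega> = x i}"
  let ?E = "\<lambda>i. real_cond_exp M (vimage_algebra (space M) Y borel) (indicator (?A i))"
  have A[measurable]: "?A i \<in> sets M" for i by measurable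
  have [measurable]: "?f i \<in> borel_measurable borel" for i
    by (rule coupling_tuple_measurable[OF M X Y X_law Y_law])
  have f: "AE \<omega> in M. p i * ?f i (Y \<omega>) = ?E i \<omega>" for i
    by (rule coupling_tuple_cond_exp[OF M X Y X_law Y_law])
  have int_A: "integrable M (indicator (?A i) :: _ \<Rightarrow> real)" for i
    by (auto simp: less_top[symmetric])
  have p: "p i \<noteq> 0" "0 < p i" for i using p_pos by (auto simp: less_imp_neq[symmetric])
  have id: "distr \<nu> borel (\<lambda>y. y) = \<nu>"
    by (rule distr_id2) (simp add: sets_\<nu>)
  have tr: "(AE y in \<nu>. P y) \<longleftrightarrow> (AE \<omega> in M. P (Y \<omega>))" if "{y \<in> space borel. P y} \<in> sets borel" for P
    unfolding Y_law[symmetric] using that by (intro AE_distr_iff) auto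
  have nonneg: "AE y in \<nu>. 0 \<le> ?f i y" for i
  proof (subst tr)
    have "AE \<omega> in M. 0 \<le> ?E i \<omega>" by (rule F.real_cond_exp_pos) auto
    with f[of i] show "AE \<omega> in M. 0 \<le> ?f i (Y \<omega>)"
      by eventually_elim (metis p(2) zero_le_mult_iff not_le)
  qed measurable
  have sum1: "AE y in \<nu>. (\<Sum>i\<in>UNIV. p i * ?f i y) = 1"
  proof (subst tr)
    have "AE \<omega> in M. (\<Sum>i\<in>UNIV. indicator (?A i) \<omega>) = (1::real)"
      using AE_source[OF M X X_law] AE_space
    proof eventually_elim
      case (elim \<omega>)
      then obtain j where j: "X \<omega> = x j" by auto
      have "(\<Sum>i\<in>UNIV. indicator (?A i) \<omega>) = (\<Sum>i\<in>UNIV. if i = j then 1 else (0::real))"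
        using inj elim by (intro sum.cong) (auto simp: j inj_eq)
      then show ?case by simp
    qed
    then have "AE \<omega> in M. real_cond_exp M (vimage_algebra (space M) Y borel) (\<lambda>\<omega>. \<Sum>i\<in>UNIV. indicator (?A i) \<omega>) \<omega>
        = real_cond_exp M (vimage_algebra (space M) Y borel) (\<lambda>\<omega>. 1) \<omega>"
      by (intro F.real_cond_exp_cong) auto
    moreover have "AE \<omega> in M. real_cond_exp M (vimage_algebra (space M) Y borel) (\<lambda>\<omega>. 1) \<omega> = 1"
      by (intro F.real_cond_exp_F_meas) auto
    moreover have "AE \<omega> in M. real_cond_exp M (vimage_algebra (space M) Y borel) (\<lambda>\<omega>. \<Sum>i\<in>UNIV. indicator (?A i) \<omega>) \<omega>
        = (\<Sum>i\<in>UNIV. ?E i \<omega>)"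
      by (intro F.real_cond_exp_sum int_A)
    moreover have "AE \<omega> in M. \<forall>i\<in>UNIV. p i * ?f i (Y \<omega>) = ?E i \<omega>"
      using f by (subst AE_finite_all) auto
    ultimately show "AE \<omega> in M. (\<Sum>i\<in>UNIV. p i * ?f i (Y \<omega>)) = 1"
      by eventually_elim simp
  qed measurable
  have hb1: "has_bochner_integral \<nu> (?f i) 1" for i
  proof -
    have "has_bochner_integral M (?E i) (p i)"
      using F.real_cond_exp_int[OF int_A[of i]] measure_source[OF M X X_law, of i]
      by (simp add: has_bochner_integral_iff Int_absorb1 Collect_mono_iff)
    then have "has_bochner_integral M (\<lambda>\<omega>. p i * ?f i (Y \<omega>)) (p i)"
      using f[of i] by (subst has_bochner_integral_cong_AE) auto
    from has_bochner_integral_mult_right[OF this, of "1 / p i"] p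
    have "has_bochner_integral M (\<lambda>\<omega>. ?f i (Y \<omega>)) 1" by simp
    then show ?thesis
      unfolding Y_law[symmetric] by (subst has_bochner_integral_distr_iff) auto
  qed
  have hb2: "has_bochner_integral \<nu> (\<lambda>y. ?f i y *\<^sub>R y) (x i)" for i
  proof -
    \<comment> \<open>Conditional probabilities lie between 0 and 1, so \<open>Y\<close> itself is a
      majorant.\<close>
    have "AE \<omega> in M. ?E i \<omega> \<le> 1" "AE \<omega> in M. 0 \<le> ?E i \<omega>"
      by (rule F.real_cond_exp_le_c[OF int_A], simp add: indicator_def)
        (rule F.real_cond_exp_pos, auto)
    then have "AE \<omega> in M. norm (?E i \<omega> *\<^sub>R Y \<omega>) \<le> norm (Y \<omega>)"
      by eventually_elim (simp add: mult_left_le_one_le)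
    then have int_EY: "integrable M (\<lambda>\<omega>. ?E i \<omega> *\<^sub>R Y \<omega>)"
      by (rule Bochner_Integration.integrable_bound[OF int, rotated]) measurable
    have "(\<integral>\<omega>. ?E i \<omega> *\<^sub>R Y \<omega> \<partial>M) = p i *\<^sub>R x i"
    proof (rule euclidean_eqI)
      fix b :: 'a assume b: "b \<in> Basis"
      have int_b: "integrable M (\<lambda>\<omega>. Y \<omega> \<bullet> b)" using int by simp
      have int_bA: "integrable M (\<lambda>\<omega>. (Y \<omega> \<bullet> b) * indicator (?A i) \<omega>)"
        by (rule integrable_real_mult_indicator[OF A int_b])
      have "(\<integral>\<omega>. ?E i \<omega> *\<^sub>R Y \<omega> \<partial>M) \<bullet> b = (\<integral>\<omega>. (Y \<omega> \<bullet> b) * ?E i \<omega> \<partial>M)"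
        by (subst integral_inner_left[symmetric]) (auto simp: int_EY mult.commute)
      also have "\<dots> = (\<integral>\<omega>. (Y \<omega> \<bullet> b) * indicator (?A i) \<omega> \<partial>M)"
        by (rule F.real_cond_exp_intg(2)[OF int_bA])
          (auto intro!: measurable_compose[OF measurable_vimage_algebra1[of Y "space M" borel], of "\<lambda>y. y \<bullet> b"])
      also have "\<dots> = (\<integral>\<omega>. indicator (?A i) \<omega> * (Y \<omega> \<bullet> b) \<partial>M)"
        by (simp add: mult.commute)
      also have "\<dots> = (\<integral>\<omega>. indicator (?A i) \<omega> * real_cond_exp M (vimage_algebra (space M) X borel) (\<lambda>\<omega>. Y \<omega> \<bullet> b) \<omega> \<partial>M)"
      proof (rule G.real_cond_exp_intg(2)[symmetric])
        show "integrable M (\<lambda>\<omega>. indicator (?A i) \<omega> * (Y \<omega> \<bullet> b))"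
          using int_bA by (simp add: mult.commute)
        have "X -` {x i} \<inter> space M \<in> sets (vimage_algebra (space M) X borel)"
          by (rule in_vimage_algebra) simp
        also have "X -` {x i} \<inter> space M = ?A i" by auto
        finally show "indicator (?A i) \<in> borel_measurable (vimage_algebra (space M) X borel)"
          by simp
      qed measurable
      also have "\<dots> = (\<integral>\<omega>. indicator (?A i) \<omega> * (x i \<bullet> b) \<partial>M)"
        by (rule integral_cong_AE) (use mart[OF b] in \<open>auto simp: indicator_def\<close>)
      also have "\<dots> = (p i *\<^sub>R x i) \<bullet> b"
        using measure_source[OF M X X_law, of i] by (simp add: Int_absorb1 Collect_mono_iff)
      finally show "(\<integral>\<omega>. ?E i \<omega> *\<^sub>R Y \<omega> \<partial>M) \<bullet> b = (p i *\<^sub>R x i) \<bullet> b" .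
    qed
    with int_EY have "has_bochner_integral M (\<lambda>\<omega>. ?E i \<omega> *\<^sub>R Y \<omega>) (p i *\<^sub>R x i)"
      by (simp add: has_bochner_integral_iff)
    then have "has_bochner_integral M (\<lambda>\<omega>. (p i * ?f i (Y \<omega>)) *\<^sub>R Y \<omega>) (p i *\<^sub>R x i)"
      by (subst has_bochner_integral_cong_AE) (use f[of i] in auto)
    from has_bochner_integral_scaleR_right[OF this, of "1 / p i"] p
    have "has_bochner_integral M (\<lambda>\<omega>. ?f i (Y \<omega>) *\<^sub>R Y \<omega>) (x i)" by simp
    then show ?thesis
      unfolding Y_law[symmetric] by (subst has_bochner_integral_distr_iff) auto
  qed
  show ?thesis
    unfolding admissible_tuples_def id using nonneg sum1 hb1 hb2 by auto
qed

text \<open>Almost surely exactly one indicator is 1, the atoms being distinct. This reduces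
  functions of \<open>X\<close> to finite sums.\<close>

lemma AE_source_sum_scaleR:
  fixes H :: "_ \<Rightarrow> 'c::real_vector"
  assumes M: "prob_space M" and X: "X \<in> borel_measurable M" and law: "distr M borel X = \<mu>"
  shows "AE \<omega> in M. H (X \<omega>) = (\<Sum>i\<in>UNIV. indicator {x i} (X \<omega>) *\<^sub>R H (x i))"
  using AE_source[OF M X law]
proof eventually_elim
  case (elim \<omega>)
  then obtain j where j: "X \<omega> = x j" by auto
  have "(\<Sum>i\<in>UNIV. indicator {x i} (X \<omega>) *\<^sub>R H (x i)) = (\<Sum>i\<in>UNIV. if i = j then H (x j) else 0)"
    using inj by (intro sum.cong) (auto simp: j inj_eq indicator_def)
  then show ?case by (simp add: j)
qed

lemma AE_source_sum:
  fixes H :: "_ \<Rightarrow> real"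
  assumes "prob_space M" and "X \<in> borel_measurable M" and "distr M borel X = \<mu>"
  shows "AE \<omega> in M. H (X \<omega>) = (\<Sum>i\<in>UNIV. H (x i) * indicator {x i} (X \<omega>))"
  using AE_source_sum_scaleR[OF assms, of H] by (simp only: real_scaleR_def mult.commute)

lemma has_bochner_integral_source:
  fixes H :: "_ \<Rightarrow> 'c::{banach, second_countable_topology}"
  assumes M: "prob_space M" and X[measurable]: "X \<in> borel_measurable M" and law: "distr M borel X = \<mu>"
    and H[measurable]: "H \<in> borel_measurable borel"
  shows "has_bochner_integral M (\<lambda>\<omega>. H (X \<omega>)) (\<Sum>i\<in>UNIV. p i *\<^sub>R H (x i))"
proof -
  interpret prob_space M by fact
  have [measurable]: "{\<omega> \<in> space M. X \<omega> = x i} \<in> sets M" for i by measurable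
  have "has_bochner_integral M (\<lambda>\<omega>. \<Sum>i\<in>UNIV. indicator {\<omega> \<in> space M. X \<omega> = x i} \<omega> *\<^sub>R H (x i))
      (\<Sum>i\<in>UNIV. measure M {\<omega> \<in> space M. X \<omega> = x i} *\<^sub>R H (x i))"
    by (intro has_bochner_integral_sum has_bochner_integral_scaleR_left has_bochner_integral_real_indicator)
      (auto simp: less_top[symmetric])
  then have "has_bochner_integral M (\<lambda>\<omega>. \<Sum>i\<in>UNIV. indicator {x i} (X \<omega>) *\<^sub>R H (x i))
      (\<Sum>i\<in>UNIV. measure M {\<omega> \<in> space M. X \<omega> = x i} *\<^sub>R H (x i))"
    by (subst (asm) has_bochner_integral_cong) (auto simp: indicator_def)
  then show ?thesis
    unfolding measure_source[OF M X law]
    by (subst has_bochner_integral_cong_AE[OF _ _ AE_source_sum_scaleR[OF M X law]]) auto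
qed

lemma measure_source_slices:
  assumes M: "prob_space M" and sets[measurable_cong]: "sets M = sets (borel \<Otimes>\<^sub>M borel)"
    and law: "distr M borel fst = \<mu>" and A[measurable]: "A \<in> sets M"
  shows "measure M A = (\<Sum>i\<in>UNIV. measure M {\<omega> \<in> space M. fst \<omega> = x i \<and> snd \<omega> \<in> Pair (x i) -` A})"
proof -
  interpret prob_space M by fact
  have [measurable]: "fst \<in> borel_measurable M" "snd \<in> borel_measurable M"
    unfolding measurable_cong_sets[OF sets refl] by auto
  have A': "A \<in> sets (borel \<Otimes>\<^sub>M borel)" using A by (simp add: sets)
  have [measurable]: "Pair (x i) -` A \<in> sets borel" for i
    by (rule sets_Pair1[OF A'])
  let ?A = "\<lambda>i. {\<omega> \<in> space M. fst \<omega> = x i \<and> snd \<omega> \<in> Pair (x i) -` A}"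
  have "measure M A = measure M (\<Union>i\<in>UNIV. ?A i)"
  proof (rule finite_measure_eq_AE)
    show "AE \<omega> in M. \<omega> \<in> A \<longleftrightarrow> \<omega> \<in> (\<Union>i\<in>UNIV. ?A i)"
      using AE_source[OF M \<open>fst \<in> borel_measurable M\<close> law] AE_space
      by eventually_elim auto
  qed measurable
  also have "\<dots> = (\<Sum>i\<in>UNIV. measure M (?A i))"
    by (rule measure_finite_Union) (use inj in \<open>auto simp: disjoint_family_on_def inj_eq\<close>)
  finally show ?thesis .
qed

lemma coupling_law_determined:
  assumes \<pi>: "\<pi> \<in> martingale_coupling_laws \<mu> \<nu>" "\<pi>' \<in> martingale_coupling_laws \<mu> \<nu>"
    and eq: "\<And>i. AE y in \<nu>. coupling_tuple \<pi> fst snd x i y = coupling_tuple \<pi>' fst snd x i y"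
  shows "\<pi> = \<pi>'"
proof (rule measure_eqI)
  show "sets \<pi> = sets \<pi>'" using \<pi> by (simp add: martingale_coupling_laws_def)
  fix A assume A: "A \<in> sets \<pi>"
  have slice: "measure \<rho> A = (\<Sum>i\<in>UNIV. \<integral>y. indicator (Pair (x i) -` A) y * (p i * coupling_tuple \<rho> fst snd x i y) \<partial>\<nu>)"
    "emeasure \<rho> A = ennreal (measure \<rho> A)" "\<And>i. coupling_tuple \<rho> fst snd x i \<in> borel_measurable borel"
    if "\<rho> \<in> martingale_coupling_laws \<mu> \<nu>" for \<rho>
  proof -
    from that have sets: "sets \<rho> = sets (borel \<Otimes>\<^sub>M borel)" and M: "prob_space \<rho>"
      and m: "fst \<in> borel_measurable \<rho>" "snd \<in> borel_measurable \<rho>"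
      and law: "distr \<rho> borel fst = \<mu>" "distr \<rho> borel snd = \<nu>"
      by (auto simp: martingale_coupling_laws_def martingale_coupling_def)
    have A': "A \<in> sets (borel \<Otimes>\<^sub>M borel)" using A \<pi> by (simp add: martingale_coupling_laws_def)
    have "Pair (x i) -` A \<in> sets borel" for i
      by (rule sets_Pair1[OF A'])
    note coupling_tuple_joint_law[OF M m law this]
    then show "measure \<rho> A = (\<Sum>i\<in>UNIV. \<integral>y. indicator (Pair (x i) -` A) y * (p i * coupling_tuple \<rho> fst snd x i y) \<partial>\<nu>)"
      using A' sets by (subst measure_source_slices[OF M sets law(1)]) auto
    interpret prob_space \<rho> by fact
    show "emeasure \<rho> A = ennreal (measure \<rho> A)" by (rule emeasure_eq_measure)
    show "coupling_tuple \<rho> fst snd x i \<in> borel_measurable borel" for i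
      by (rule coupling_tuple_measurable[OF M m law])
  qed
  have A': "A \<in> sets (borel \<Otimes>\<^sub>M borel)" using A \<pi> by (simp add: martingale_coupling_laws_def)
  have [measurable]: "Pair (x i) -` A \<in> sets borel" for i
    by (rule sets_Pair1[OF A'])
  note [measurable] = slice(3)[OF \<pi>(1)] slice(3)[OF \<pi>(2)]
  have "measure \<pi> A = measure \<pi>' A"
    unfolding slice(1)[OF \<pi>(1)] slice(1)[OF \<pi>(2)]
  proof (intro sum.cong refl integral_cong_AE)
    fix i
    show "AE y in \<nu>. indicator (Pair (x i) -` A) y * (p i * coupling_tuple \<pi> fst snd x i y) =
        indicator (Pair (x i) -` A) y * (p i * coupling_tuple \<pi>' fst snd x i y)"
      using eq[of i] by eventually_elim simp
  qed measurable
  then show "emeasure \<pi> A = emeasure \<pi>' A"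
    by (simp add: slice(2)[OF \<pi>(1)] slice(2)[OF \<pi>(2)])
qed

section \<open>From density tuples back to couplings\<close>

text \<open>The candidate inverse: draw \<open>y\<close> from \<nu>, then the index \<open>i\<close>
  with probability \<open>p i * f i y\<close>. \<open>ennreal\<close> cuts off negative values,
  which for an admissible tuple occur only on a \<nu>-null set.\<close>

definition tuple_law :: "('m \<Rightarrow> 'a \<Rightarrow> real) \<Rightarrow> ('a \<times> 'a) measure" where
  "tuple_law f = distr (density (count_space UNIV \<Otimes>\<^sub>M \<nu>) (\<lambda>(i, y). ennreal (p i * f i y)))
     (borel \<Otimes>\<^sub>M borel) (\<lambda>(i, y). (x i, y))"

lemma sets_tuple_law [measurable_cong]: "sets (tuple_law f) = sets (borel \<Otimes>\<^sub>M borel)"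
  by (simp add: tuple_law_def)

lemma nn_integral_tuple_law:
  assumes [measurable]: "\<And>i. f i \<in> borel_measurable borel" "F \<in> borel_measurable (borel \<Otimes>\<^sub>M borel)"
  shows "(\<integral>\<^sup>+\<omega>. F \<omega> \<partial>tuple_law f) = (\<Sum>i\<in>UNIV. \<integral>\<^sup>+y. ennreal (p i * f i y) * F (x i, y) \<partial>\<nu>)"
proof -
  interpret \<nu>: prob_space \<nu> by (rule prob_\<nu>)
  have m1[measurable]: "(\<lambda>(i, y). ennreal (p i * f i y)) \<in> borel_measurable (count_space UNIV \<Otimes>\<^sub>M \<nu>)"
    by (rule measurable_pair_measure_countable1) auto
  have m2[measurable]: "(\<lambda>(i, y). (x i, y)) \<in> count_space UNIV \<Otimes>\<^sub>M \<nu> \<rightarrow>\<^sub>M borel \<Otimes>\<^sub>M borel"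
    by (rule measurable_pair_measure_countable1) auto
  let ?D = "density (count_space UNIV \<Otimes>\<^sub>M \<nu>) (\<lambda>(i, y). ennreal (p i * f i y))"
  have "(\<lambda>(i, y). (x i, y)) \<in> ?D \<rightarrow>\<^sub>M borel \<Otimes>\<^sub>M borel"
    using m2 unfolding measurable_cong_sets[OF sets_density refl] .
  then have "(\<integral>\<^sup>+\<omega>. F \<omega> \<partial>tuple_law f) = (\<integral>\<^sup>+z. F (case z of (i, y) \<Rightarrow> (x i, y)) \<partial>?D)"
    unfolding tuple_law_def by (rule nn_integral_distr) (simp add: assms(2))
  also have "\<dots> = (\<integral>\<^sup>+z. (case z of (i, y) \<Rightarrow> ennreal (p i * f i y)) * F (case z of (i, y) \<Rightarrow> (x i, y))
      \<partial>(count_space UNIV \<Otimes>\<^sub>M \<nu>))"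
    by (rule nn_integral_density[OF m1]) (rule measurable_compose[OF m2 assms(2)])
  also have "\<dots> = (\<integral>\<^sup>+i. \<integral>\<^sup>+y. ennreal (p i * f i y) * F (x i, y) \<partial>\<nu> \<partial>count_space UNIV)"
    by (subst \<nu>.nn_integral_fst[symmetric])
      (intro borel_measurable_times_ennreal m1 measurable_compose[OF m2 assms(2)], simp only: prod.case)
  also have "\<dots> = (\<Sum>i\<in>UNIV. \<integral>\<^sup>+y. ennreal (p i * f i y) * F (x i, y) \<partial>\<nu>)"
    by (rule nn_integral_count_space_finite) simp
  finally show ?thesis .
qed

lemma admissible_tuplesD:
  assumes "f \<in> admissible_tuples \<nu> (\<lambda>y. y) p x"
  shows "f i \<in> borel_measurable borel" "AE y in \<nu>. 0 \<le> f i y" "AE y in \<nu>. (\<Sum>i\<in>UNIV. p i * f i y) = 1"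
    "has_bochner_integral \<nu> (f i) 1" "has_bochner_integral \<nu> (\<lambda>y. f i y *\<^sub>R y) (x i)"
proof -
  have id: "distr \<nu> borel (\<lambda>y. y) = \<nu>"
    by (rule distr_id2) (simp add: sets_\<nu>)
  show "f i \<in> borel_measurable borel" "AE y in \<nu>. 0 \<le> f i y" "AE y in \<nu>. (\<Sum>i\<in>UNIV. p i * f i y) = 1"
    "has_bochner_integral \<nu> (f i) 1" "has_bochner_integral \<nu> (\<lambda>y. f i y *\<^sub>R y) (x i)"
    using assms unfolding admissible_tuples_def id by blast+
qed

text \<open>The identity is first shown for nonnegative integrals and then applied to
  \<open>H\<close> and \<open>- H\<close>. Injectivity of \<open>x\<close> selects one summand, and
  nonnegativity of \<open>f i\<close> lets the weight pass through \<open>ennreal\<close>.\<close>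

lemma integral_tuple_law_slice:
  assumes f: "f \<in> admissible_tuples \<nu> (\<lambda>y. y) p x"
    and H[measurable]: "H \<in> borel_measurable borel"
    and int: "integrable (tuple_law f) (\<lambda>\<omega>. indicator {x i} (fst \<omega>) * H (snd \<omega>))"
    and int': "integrable \<nu> (\<lambda>y. p i * f i y * H y)"
  shows "(\<integral>\<omega>. indicator {x i} (fst \<omega>) * H (snd \<omega>) \<partial>tuple_law f) = (\<integral>y. p i * f i y * H y \<partial>\<nu>)"
proof -
  have m[measurable]: "f j \<in> borel_measurable borel" for j
    by (rule admissible_tuplesD[OF f])
  note nn = admissible_tuplesD(2)[OF f, of i]
  have "(\<integral>\<^sup>+\<omega>. ennreal (indicator {x i} (fst \<omega>) * G (snd \<omega>)) \<partial>tuple_law f) = (\<integral>\<^sup>+y. ennreal (p i * f i y * G y) \<partial>\<nu>)"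
    if [measurable]: "G \<in> borel_measurable borel" for G
  proof -
    have "(\<integral>\<^sup>+\<omega>. ennreal (indicator {x i} (fst \<omega>) * G (snd \<omega>)) \<partial>tuple_law f) =
        (\<Sum>j\<in>UNIV. \<integral>\<^sup>+y. ennreal (p j * f j y) * ennreal (indicator {x i} (x j) * G y) \<partial>\<nu>)"
      by (subst nn_integral_tuple_law) auto
    also have "\<dots> = (\<Sum>j\<in>UNIV. if j = i then \<integral>\<^sup>+y. ennreal (p i * f i y) * ennreal (G y) \<partial>\<nu> else 0)"
      using inj by (intro sum.cong) (auto simp: inj_eq indicator_def)
    also have "\<dots> = (\<integral>\<^sup>+y. ennreal (p i * f i y) * ennreal (G y) \<partial>\<nu>)" by simp
    also have "\<dots> = (\<integral>\<^sup>+y. ennreal (p i * f i y * G y) \<partial>\<nu>)"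
    proof (rule nn_integral_cong_AE)
      show "AE y in \<nu>. ennreal (p i * f i y) * ennreal (G y) = ennreal (p i * f i y * G y)"
        using nn by eventually_elim (use p_pos in \<open>simp add: ennreal_mult' less_imp_le\<close>)
    qed
    finally show ?thesis .
  qed
  from this[of H] this[of "\<lambda>y. - H y"] show ?thesis
    by (simp add: real_lebesgue_integral_def[OF int] real_lebesgue_integral_def[OF int'])
qed

text \<open>Each condition on the tuple yields one property: unit mass gives the first law, the
  partition of unity the second, and the mean condition the martingale property.\<close>

lemma tuple_law_coupling:
  assumes f: "f \<in> admissible_tuples \<nu> (\<lambda>y. y) p x" and int_\<nu>: "integrable \<nu> (\<lambda>y. y)"
  shows "tuple_law f \<in> martingale_coupling_laws \<mu> \<nu>"
    and "AE y in \<nu>. coupling_tuple (tuple_law f) fst snd x i y = f i y"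
proof -
  let ?\<pi> = "tuple_law f"
  interpret \<nu>: prob_space \<nu> by (rule prob_\<nu>)
  have m[measurable]: "f j \<in> borel_measurable borel" for j
    by (rule admissible_tuplesD[OF f])
  have nn: "AE y in \<nu>. \<forall>i\<in>UNIV. 0 \<le> f i y"
    by (subst AE_finite_all) (use admissible_tuplesD(2)[OF f] in auto)
  note sum1 = admissible_tuplesD(3)[OF f]
  note hb1 = admissible_tuplesD(4)[OF f] and hb2 = admissible_tuplesD(5)[OF f]
  have p: "0 \<le> p j" "p j \<noteq> 0" for j using p_pos by (auto simp: less_imp_le less_imp_neq[symmetric])
  have space: "space ?\<pi> = UNIV" using sets_eq_imp_space_eq[OF sets_tuple_law] by (simp add: space_pair_measure)
  have fst_m[measurable]: "fst \<in> borel_measurable ?\<pi>" and snd_m[measurable]: "snd \<in> borel_measurable ?\<pi>"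
    by (measurable)
  have mass: "(\<integral>\<^sup>+y. ennreal (p j * f j y) \<partial>\<nu>) = ennreal (p j)" for j
  proof -
    have "(\<integral>\<^sup>+y. ennreal (p j * f j y) \<partial>\<nu>) = ennreal (\<integral>y. p j * f j y \<partial>\<nu>)"
      using hb1[of j] nn p(1)[of j]
      by (intro nn_integral_eq_integral) (auto simp: has_bochner_integral_iff)
    then show ?thesis using hb1[of j] by (simp add: has_bochner_integral_iff)
  qed
  have fst_law: "distr ?\<pi> borel fst = \<mu>"
  proof (rule measure_eqI)
    fix A assume "A \<in> sets (distr ?\<pi> borel fst)"
    then have A[measurable]: "A \<in> sets borel" by simp
    have "emeasure (distr ?\<pi> borel fst) A = (\<integral>\<^sup>+\<omega>. indicator A (fst \<omega>) \<partial>?\<pi>)"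
      by (subst nn_integral_indicator[symmetric], simp) (subst nn_integral_distr, auto)
    also have "\<dots> = (\<Sum>j\<in>UNIV. ennreal (p j) * indicator A (x j))"
      by (subst nn_integral_tuple_law) (auto simp: nn_integral_multc mass)
    finally show "emeasure (distr ?\<pi> borel fst) A = emeasure \<mu> A" by (simp add: \<mu>)
  qed (simp add: sets_\<mu>)
  have snd_law: "distr ?\<pi> borel snd = \<nu>"
  proof (rule measure_eqI)
    fix A assume "A \<in> sets (distr ?\<pi> borel snd)"
    then have A[measurable]: "A \<in> sets borel" by simp
    have "emeasure (distr ?\<pi> borel snd) A = (\<integral>\<^sup>+\<omega>. indicator A (snd \<omega>) \<partial>?\<pi>)"
      by (subst nn_integral_indicator[symmetric], simp) (subst nn_integral_distr, auto)
    also have "\<dots> = (\<Sum>j\<in>UNIV. \<integral>\<^sup>+y. ennreal (p j * f j y) * indicator A y \<partial>\<nu>)"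
      by (subst nn_integral_tuple_law) auto
    also have "\<dots> = (\<integral>\<^sup>+y. (\<Sum>j\<in>UNIV. ennreal (p j * f j y) * indicator A y) \<partial>\<nu>)"
      by (rule nn_integral_sum[symmetric]) auto
    also have "\<dots> = (\<integral>\<^sup>+y. indicator A y \<partial>\<nu>)"
    proof (rule nn_integral_cong_AE)
      show "AE y in \<nu>. (\<Sum>j\<in>UNIV. ennreal (p j * f j y) * indicator A y) = indicator A y"
        using nn sum1
      proof eventually_elim
        case (elim y)
        have "(\<Sum>j\<in>UNIV. ennreal (p j * f j y)) = ennreal (\<Sum>j\<in>UNIV. p j * f j y)"
          using elim p by (intro sum_ennreal) simp
        then show ?case using elim by (simp flip: sum_distrib_right)
      qed
    qed
    also have "\<dots> = emeasure \<nu> A" by (simp add: sets_\<nu>)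
    finally show "emeasure (distr ?\<pi> borel snd) A = emeasure \<nu> A" .
  qed (simp add: sets_\<nu>)
  \<comment> \<open>Total mass 1 is inherited from the second marginal.\<close>
  have M: "prob_space ?\<pi>"
    by (rule prob_space_distrD[OF snd_m]) (simp add: snd_law prob_\<nu>)
  interpret prob_space ?\<pi> by fact
  have int_snd: "integrable ?\<pi> snd"
    using integrable_distr[OF snd_m, of "\<lambda>y. y"] int_\<nu> by (simp only: snd_law)
  have int_ind: "integrable ?\<pi> (\<lambda>\<omega>. indicator {x j} (fst \<omega>) * H (snd \<omega>))"
    if "integrable ?\<pi> (\<lambda>\<omega>. H (snd \<omega>) :: real)" for j H
  proof -
    have "integrable ?\<pi> (\<lambda>\<omega>. indicator {\<omega> \<in> space ?\<pi>. fst \<omega> = x j} \<omega> *\<^sub>R H (snd \<omega>))"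
      by (intro integrable_mult_indicator that) measurable
    then show ?thesis by (simp add: space indicator_def cong: if_cong)
  qed
  have mart: "AE \<omega> in ?\<pi>. real_cond_exp ?\<pi> (vimage_algebra (space ?\<pi>) fst borel) (\<lambda>\<omega>. snd \<omega> \<bullet> b) \<omega> = fst \<omega> \<bullet> b" for b
  proof (rule real_cond_exp_vimage_charact[OF M fst_m])
    show int_sb: "integrable ?\<pi> (\<lambda>\<omega>. snd \<omega> \<bullet> b)" using int_snd by simp
    have slice: "(\<integral>\<omega>. indicator {x j} (fst \<omega>) * (snd \<omega> \<bullet> b) \<partial>?\<pi>) = p j * (x j \<bullet> b)" for j
    proof -
      have int_fb: "integrable \<nu> (\<lambda>y. p j * ((f j y *\<^sub>R y) \<bullet> b))"
        using hb2[of j] by (intro integrable_mult_right integrable_inner_left) (auto simp: has_bochner_integral_iff)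
      have "(\<integral>\<omega>. indicator {x j} (fst \<omega>) * (snd \<omega> \<bullet> b) \<partial>?\<pi>) = (\<integral>y. p j * f j y * (y \<bullet> b) \<partial>\<nu>)"
        by (rule integral_tuple_law_slice[OF f]) (use int_ind[OF int_sb] int_fb in \<open>auto simp: mult.assoc\<close>)
      also have "\<dots> = p j * ((\<integral>y. f j y *\<^sub>R y \<partial>\<nu>) \<bullet> b)"
        using hb2[of j] by (subst integral_inner_left[symmetric]) (auto simp: has_bochner_integral_iff mult.assoc)
      finally show ?thesis using hb2[of j] by (simp add: has_bochner_integral_iff)
    qed
    have ind_j: "(\<integral>\<omega>. indicator {x j} (fst \<omega>) \<partial>?\<pi>) = p j" for j
    proof -
      have "(\<integral>\<omega>. indicator {x j} (fst \<omega>) \<partial>?\<pi>) = (\<integral>\<omega>. indicat_real {\<omega> \<in> space ?\<pi>. fst \<omega> = x j} \<omega> \<partial>?\<pi>)"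
        by (intro Bochner_Integration.integral_cong) (auto simp: indicator_def)
      then show ?thesis
        using measure_source[OF M fst_m fst_law, of j] by (simp add: space)
    qed
    have int_j: "integrable ?\<pi> (\<lambda>\<omega>. indicator {x j} (fst \<omega>) :: real)" for j
      using int_ind[of "\<lambda>_. 1" j] by simp
    show "integrable ?\<pi> (\<lambda>\<omega>. fst \<omega> \<bullet> b)"
    proof (subst integrable_cong_AE[OF _ _ AE_source_sum[OF M fst_m fst_law, of "\<lambda>z. z \<bullet> b"]])
      show "integrable ?\<pi> (\<lambda>\<omega>. \<Sum>i\<in>UNIV. x i \<bullet> b * indicator {x i} (fst \<omega>))"
        by (intro Bochner_Integration.integrable_sum integrable_mult_right int_j)
    qed measurable
    fix B :: "'a set" assume B[measurable]: "B \<in> sets borel"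
    \<comment> \<open>A test function of the first coordinate is a finite combination of indicators
      of atoms, so the martingale identity reduces to \<open>slice\<close>.\<close>
    have "(\<integral>\<omega>. indicator B (fst \<omega>) * (snd \<omega> \<bullet> b) \<partial>?\<pi>) =
        (\<integral>\<omega>. (\<Sum>i\<in>UNIV. indicator B (x i) * (indicator {x i} (fst \<omega>) * (snd \<omega> \<bullet> b))) \<partial>?\<pi>)"
    proof (rule integral_cong_AE)
      show "AE \<omega> in ?\<pi>. indicator B (fst \<omega>) * (snd \<omega> \<bullet> b) =
          (\<Sum>i\<in>UNIV. indicator B (x i) * (indicator {x i} (fst \<omega>) * (snd \<omega> \<bullet> b)))"
        using AE_source_sum[OF M fst_m fst_law, of "indicator B"]
        by eventually_elim (simp only: mult.assoc[symmetric] sum_distrib_right)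
    qed measurable
    also have "\<dots> = (\<Sum>i\<in>UNIV. indicator B (x i) * (p i * (x i \<bullet> b)))"
      by (subst Bochner_Integration.integral_sum, intro integrable_mult_right int_ind[OF int_sb])
        (simp only: integral_mult_right_zero slice)
    also have "\<dots> = (\<integral>\<omega>. (\<Sum>i\<in>UNIV. (indicator B (x i) * (x i \<bullet> b)) * indicator {x i} (fst \<omega>)) \<partial>?\<pi>)"
      by (subst Bochner_Integration.integral_sum, intro integrable_mult_right int_j)
        (simp only: integral_mult_right_zero ind_j mult_ac)
    also have "\<dots> = (\<integral>\<omega>. indicator B (fst \<omega>) * (fst \<omega> \<bullet> b) \<partial>?\<pi>)"
    proof (rule integral_cong_AE)
      show "AE \<omega> in ?\<pi>. (\<Sum>i\<in>UNIV. (indicator B (x i) * (x i \<bullet> b)) * indicator {x i} (fst \<omega>)) =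
          indicator B (fst \<omega>) * (fst \<omega> \<bullet> b)"
        using AE_source_sum[OF M fst_m fst_law, of "\<lambda>z. indicator B z * (z \<bullet> b)"]
        by eventually_elim simp
    qed measurable
    finally show "(\<integral>\<omega>. indicator B (fst \<omega>) * (snd \<omega> \<bullet> b) \<partial>?\<pi>) = (\<integral>\<omega>. indicator B (fst \<omega>) * (fst \<omega> \<bullet> b) \<partial>?\<pi>)" .
  qed measurable
  show "?\<pi> \<in> martingale_coupling_laws \<mu> \<nu>"
    using M fst_law snd_law int_snd mart
    by (simp add: martingale_coupling_laws_def martingale_coupling_def sets_tuple_law)
  have int_f: "integrable \<nu> (\<lambda>y. p i * f i y)" using hb1[of i] by (simp add: has_bochner_integral_iff)
  have "AE \<omega> in ?\<pi>. real_cond_exp ?\<pi> (vimage_algebra (space ?\<pi>) snd borel)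
      (indicator {\<omega> \<in> space ?\<pi>. fst \<omega> = x i}) \<omega> = p i * f i (snd \<omega>)"
  proof (rule real_cond_exp_vimage_charact[OF M snd_m])
    show "integrable ?\<pi> (indicator {\<omega> \<in> space ?\<pi>. fst \<omega> = x i} :: _ \<Rightarrow> real)"
      by (auto simp: less_top[symmetric])
    show "integrable ?\<pi> (\<lambda>\<omega>. p i * f i (snd \<omega>))"
      using integrable_distr[OF snd_m, of "\<lambda>y. p i * f i y"] int_f by (simp only: snd_law)
    fix B :: "'a set" assume B[measurable]: "B \<in> sets borel"
    have "(\<integral>\<omega>. indicator B (snd \<omega>) * indicator {\<omega> \<in> space ?\<pi>. fst \<omega> = x i} \<omega> \<partial>?\<pi>)
        = (\<integral>\<omega>. indicator {x i} (fst \<omega>) * indicator B (snd \<omega>) \<partial>?\<pi> :: real)"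
      by (intro Bochner_Integration.integral_cong) (auto simp: indicator_def)
    also have "\<dots> = (\<integral>y. p i * f i y * indicator B y \<partial>\<nu>)"
    proof (rule integral_tuple_law_slice[OF f])
      show "integrable ?\<pi> (\<lambda>\<omega>. indicator {x i} (fst \<omega>) * indicator B (snd \<omega>) :: real)"
        by (intro int_ind integrable_const_bound[where B = 1]) (auto simp: indicator_def)
      show "integrable \<nu> (\<lambda>y. p i * f i y * indicator B y)"
        by (intro integrable_real_mult_indicator int_f) (simp add: sets_\<nu>)
    qed measurable
    also have "\<dots> = (\<integral>\<omega>. indicator B (snd \<omega>) * (p i * f i (snd \<omega>)) \<partial>?\<pi>)"
      using integral_distr[OF snd_m, of "\<lambda>y. p i * f i y * indicator B y"] by (simp add: snd_law mult_ac)
    finally show "(\<integral>\<omega>. indicator B (snd \<omega>) * indicator {\<omega> \<in> space ?\<pi>. fst \<omega> = x i} \<omega> \<partial>?\<pi>) =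
        (\<integral>\<omega>. indicator B (snd \<omega>) * (p i * f i (snd \<omega>)) \<partial>?\<pi>)" .
  qed measurable
  with coupling_tuple_cond_exp[OF M fst_m snd_m fst_law snd_law, of i]
  have "AE \<omega> in ?\<pi>. coupling_tuple ?\<pi> fst snd x i (snd \<omega>) = f i (snd \<omega>)"
    by eventually_elim (use p in auto)
  note [measurable] = coupling_tuple_measurable[OF M fst_m snd_m fst_law snd_law]
  have "(AE y in distr ?\<pi> borel snd. coupling_tuple ?\<pi> fst snd x i y = f i y) \<longleftrightarrow>
      (AE \<omega> in ?\<pi>. coupling_tuple ?\<pi> fst snd x i (snd \<omega>) = f i (snd \<omega>))"
    by (rule AE_distr_iff) measurable
  then show "AE y in \<nu>. coupling_tuple ?\<pi> fst snd x i y = f i y"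
    using \<open>AE \<omega> in ?\<pi>. coupling_tuple ?\<pi> fst snd x i (snd \<omega>) = f i (snd \<omega>)\<close> by (simp only: snd_law)
qed

text \<open>The target is a quotient because a conditional probability given \<open>Y\<close> is
  fixed only up to \<nu>-null sets. \<open>coupling_law_determined\<close> gives injectivity, and
  \<open>tuple_law\<close> supplies preimages.\<close>

theorem coupling_tuple_bij_betw:
  assumes int_\<nu>: "integrable \<nu> (\<lambda>y. y)"
  defines "C \<equiv> admissible_tuples \<nu> (\<lambda>y. y) p x"
  shows "bij_betw (\<lambda>\<pi>. ae_eq_tuples \<nu> C `` {coupling_tuple \<pi> fst snd x})
    (martingale_coupling_laws \<mu> \<nu>) (C // ae_eq_tuples \<nu> C)"
proof -
  have adm: "coupling_tuple \<pi> fst snd x \<in> C" if "\<pi> \<in> martingale_coupling_laws \<mu> \<nu>" for \<pi>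
    unfolding C_def by (rule coupling_tuple_admissible) (use that in \<open>simp add: martingale_coupling_laws_def\<close>)
  have equiv: "equiv C (ae_eq_tuples \<nu> C)"
  proof (rule equivI)
    show "refl_on C (ae_eq_tuples \<nu> C)" by (auto simp: refl_on_def ae_eq_tuples_def)
    show "sym (ae_eq_tuples \<nu> C)" by (auto simp: sym_def ae_eq_tuples_def eq_commute)
    show "trans (ae_eq_tuples \<nu> C)"
    proof (rule transI)
      fix f g h assume fg: "(f, g) \<in> ae_eq_tuples \<nu> C" and gh: "(g, h) \<in> ae_eq_tuples \<nu> C"
      have "AE y in \<nu>. f i y = h i y" for i
      proof -
        have "AE y in \<nu>. f i y = g i y" "AE y in \<nu>. g i y = h i y"
          using fg gh by (auto simp: ae_eq_tuples_def)
        then show ?thesis by eventually_elim simp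
      qed
      then show "(f, h) \<in> ae_eq_tuples \<nu> C" using fg gh by (auto simp: ae_eq_tuples_def)
    qed
  qed (auto simp: ae_eq_tuples_def)
  show ?thesis
  proof (rule bij_betw_imageI)
    show "inj_on (\<lambda>\<pi>. ae_eq_tuples \<nu> C `` {coupling_tuple \<pi> fst snd x}) (martingale_coupling_laws \<mu> \<nu>)"
    proof (rule inj_onI)
      fix \<pi> \<pi>' assume \<pi>: "\<pi> \<in> martingale_coupling_laws \<mu> \<nu>" "\<pi>' \<in> martingale_coupling_laws \<mu> \<nu>"
        and "ae_eq_tuples \<nu> C `` {coupling_tuple \<pi> fst snd x} = ae_eq_tuples \<nu> C `` {coupling_tuple \<pi>' fst snd x}"
      then have "(coupling_tuple \<pi> fst snd x, coupling_tuple \<pi>' fst snd x) \<in> ae_eq_tuples \<nu> C"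
        using eq_equiv_class_iff[OF equiv adm adm] by blast
      then show "\<pi> = \<pi>'"
        by (intro coupling_law_determined[OF \<pi>]) (auto simp: ae_eq_tuples_def)
    qed
    show "(\<lambda>\<pi>. ae_eq_tuples \<nu> C `` {coupling_tuple \<pi> fst snd x}) ` martingale_coupling_laws \<mu> \<nu> = C // ae_eq_tuples \<nu> C"
    proof (intro equalityI subsetI)
      fix S assume "S \<in> C // ae_eq_tuples \<nu> C"
      then obtain f where f: "f \<in> C" "S = ae_eq_tuples \<nu> C `` {f}" by (auto elim: quotientE)
      note law = tuple_law_coupling[OF f(1)[unfolded C_def] int_\<nu>]
      have "(coupling_tuple (tuple_law f) fst snd x, f) \<in> ae_eq_tuples \<nu> C"
        using law adm f(1) by (auto simp: ae_eq_tuples_def)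
      then have "S = ae_eq_tuples \<nu> C `` {coupling_tuple (tuple_law f) fst snd x}"
        using equiv_class_eq[OF equiv] f(2) by blast
      then show "S \<in> (\<lambda>\<pi>. ae_eq_tuples \<nu> C `` {coupling_tuple \<pi> fst snd x}) ` martingale_coupling_laws \<mu> \<nu>"
        using law(1) by blast
    qed (auto intro: quotientI adm)
  qed
qed

end

section \<open>Strict convex order and Gibbs tuples\<close>

lemma integrable_Pair:
  fixes f :: "_ \<Rightarrow> 'b::euclidean_space" and g :: "_ \<Rightarrow> 'c::euclidean_space"
  assumes f: "integrable M f" and g: "integrable M g"
  shows "integrable M (\<lambda>\<omega>. (f \<omega>, g \<omega>))"
proof (rule Bochner_Integration.integrable_bound)
  show "integrable M (\<lambda>\<omega>. norm (f \<omega>) + norm (g \<omega>))" using f g by simp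
  show "(\<lambda>\<omega>. (f \<omega>, g \<omega>)) \<in> borel_measurable M"
    using f g by (intro borel_measurable_Pair) auto
  show "AE \<omega> in M. norm (f \<omega>, g \<omega>) \<le> norm (norm (f \<omega>) + norm (g \<omega>))"
    by (intro AE_I2) (simp add: norm_Pair_le)
qed

lemma integral_Pair:
  fixes f :: "_ \<Rightarrow> 'b::euclidean_space" and g :: "_ \<Rightarrow> 'c::euclidean_space"
  assumes f: "integrable M f" and g: "integrable M g"
  shows "(\<integral>\<omega>. (f \<omega>, g \<omega>) \<partial>M) = (\<integral>\<omega>. f \<omega> \<partial>M, \<integral>\<omega>. g \<omega> \<partial>M)"
  using integral_bounded_linear[OF bounded_linear_fst integrable_Pair[OF f g]]
    integral_bounded_linear[OF bounded_linear_snd integrable_Pair[OF f g]]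
  by (simp add: prod_eq_iff)

lemma convex_Max_affine:
  fixes a :: "'m::finite \<Rightarrow> real" and u :: "'m \<Rightarrow> 'a::real_inner"
  shows "convex_on UNIV (\<lambda>y. Max (range (\<lambda>i. a i + u i \<bullet> y)))"
proof (rule convex_onI)
  fix t :: real and y z :: 'a
  assume t: "0 < t" "t < 1"
  let ?g = "\<lambda>y. Max (range (\<lambda>i. a i + u i \<bullet> y))"
  have le: "a i + u i \<bullet> y \<le> ?g y" for i y by (intro Max_ge) auto
  have "a i + u i \<bullet> ((1 - t) *\<^sub>R y + t *\<^sub>R z) \<le> (1 - t) * ?g y + t * ?g z" for i
  proof -
    have "a i + u i \<bullet> ((1 - t) *\<^sub>R y + t *\<^sub>R z) = (1 - t) * (a i + u i \<bullet> y) + t * (a i + u i \<bullet> z)"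
      by (simp add: inner_add_right algebra_simps)
    also have "\<dots> \<le> (1 - t) * ?g y + t * ?g z"
      using t by (intro add_mono mult_left_mono le) auto
    finally show ?thesis .
  qed
  then show "?g ((1 - t) *\<^sub>R y + t *\<^sub>R z) \<le> (1 - t) * ?g y + t * ?g z"
    by (intro Max.boundedI) auto
qed simp

context finite_source begin

lemma ext_expectation_source:
  assumes M: "prob_space M" and X: "X \<in> borel_measurable M" and law: "distr M borel X = \<mu>"
    and g: "convex_on UNIV g"
  shows "ext_expectation M (\<lambda>\<omega>. g (X \<omega>)) = ereal (\<Sum>i\<in>UNIV. p i * g (x i))"
proof -
  have "g \<in> borel_measurable borel"
    by (rule borel_measurable_continuous_onI[OF convex_on_continuous[OF open_UNIV g]])
  from has_bochner_integral_source[OF M X law this] show ?thesis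
    by (simp add: has_bochner_integral_iff ext_expectation_integrable)
qed

text \<open>Jensen's inequality atom by atom: \<open>h i\<close> is a density with respect to \<nu>
  of a law with mean \<open>z i\<close>, and scaling by \<open>s\<close> moves this mean to
  \<open>x i\<close>. The averaged minorant \<open>A\<close> has only terms \<open>h i\<close> and
  \<open>h i y *\<^sub>R y\<close>, so it is integrable even when the convex function of
  \<open>Y\<close> is not.\<close>

lemma convex_order_of_weights:
  assumes M: "prob_space M" "X \<in> borel_measurable M" "distr M borel X = \<mu>"
    and Y[measurable]: "Y \<in> borel_measurable N" and Y_law: "distr N borel Y = \<nu>"
    and h[measurable]: "\<And>i. h i \<in> borel_measurable \<nu>" and h_nn: "\<And>i y. 0 \<le> h i y"
    and h_sum: "\<And>y. (\<Sum>i\<in>UNIV. p i * h i y) = 1"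
    and h1: "\<And>i. has_bochner_integral \<nu> (h i) 1"
    and h2: "\<And>i. has_bochner_integral \<nu> (\<lambda>y. h i y *\<^sub>R y) (z i)"
    and z: "\<And>i. s *\<^sub>R z i = x i"
  shows "convex_order M X N (\<lambda>\<omega>. s *\<^sub>R Y \<omega>)"
  unfolding convex_order_def
proof (intro allI impI)
  fix g :: "'a \<Rightarrow> real" assume g: "convex_on UNIV g"
  have "\<forall>i. \<exists>v. \<forall>y. g (x i) + v \<bullet> (y - x i) \<le> g y"
    using convex_affine_minorant[OF g] by metis
  then obtain v where v: "\<And>i y. g (x i) + v i \<bullet> (y - x i) \<le> g y" by metis
  define A where "A y = (\<Sum>i\<in>UNIV. p i * (h i y * (g (x i) - v i \<bullet> x i) + s * (v i \<bullet> (h i y *\<^sub>R y))))" for y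
  have "A y \<le> g (s *\<^sub>R y)" for y
  proof -
    have "A y = (\<Sum>i\<in>UNIV. (p i * h i y) * (g (x i) + v i \<bullet> (s *\<^sub>R y - x i)))"
      unfolding A_def by (intro sum.cong refl) (simp add: inner_diff_right algebra_simps)
    also have "\<dots> \<le> (\<Sum>i\<in>UNIV. (p i * h i y) * g (s *\<^sub>R y))"
      using h_nn p_pos by (intro sum_mono mult_left_mono v) (simp add: less_imp_le)
    also have "\<dots> = g (s *\<^sub>R y)" by (simp add: h_sum flip: sum_distrib_right)
    finally show ?thesis .
  qed
  moreover have "has_bochner_integral \<nu> A (\<Sum>i\<in>UNIV. p i * g (x i))"
  proof -
    have "has_bochner_integral \<nu> A (\<Sum>i\<in>UNIV. p i * (1 * (g (x i) - v i \<bullet> x i) + s * (v i \<bullet> z i)))"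
      unfolding A_def[abs_def]
      by (intro has_bochner_integral_sum has_bochner_integral_mult_right has_bochner_integral_add
          has_bochner_integral_mult_left has_bochner_integral_inner_right h1 h2)
    \<comment> \<open>After scaling, the mean under \<open>h i\<close> is the base point of the
      minorant, so its linear part integrates to 0.\<close>
    moreover have "s * (v i \<bullet> z i) = v i \<bullet> x i" for i
      by (simp flip: z)
    ultimately show ?thesis by simp
  qed
  then have "has_bochner_integral N (\<lambda>\<omega>. A (Y \<omega>)) (\<Sum>i\<in>UNIV. p i * g (x i))"
  proof -
    assume A: "has_bochner_integral \<nu> A (\<Sum>i\<in>UNIV. p i * g (x i))"
    then have "A \<in> borel_measurable \<nu>" by (auto simp: has_bochner_integral_iff)
    then have "A \<in> borel_measurable borel" by (simp add: measurable_cong_sets[OF sets_\<nu> refl])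
    from has_bochner_integral_distr_iff[OF Y this] A show ?thesis by (simp only: Y_law)
  qed
  then have "ext_expectation N (\<lambda>\<omega>. A (Y \<omega>)) = ereal (\<Sum>i\<in>UNIV. p i * g (x i))"
    by (simp add: has_bochner_integral_iff ext_expectation_integrable)
  ultimately show "ext_expectation M (\<lambda>\<omega>. g (X \<omega>)) \<le> ext_expectation N (\<lambda>\<omega>. g (s *\<^sub>R Y \<omega>))"
    unfolding ext_expectation_source[OF M g]
    using ext_expectation_mono_AE[where M = N and f = "\<lambda>\<omega>. A (Y \<omega>)" and g = "\<lambda>\<omega>. g (s *\<^sub>R Y \<omega>)"] by simp
qed

lemma gibbs_imp_strict_convex_order:
  assumes M: "prob_space M" "X \<in> borel_measurable M" "distr M borel X = \<mu>"
    and Y: "Y \<in> borel_measurable N" "distr N borel Y = \<nu>"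
    and ac: "absolutely_continuous lborel \<nu>" and mean: "(\<Sum>i\<in>UNIV. p i *\<^sub>R x i) = 0"
    and f: "f \<in> admissible_tuples \<nu> (\<lambda>y. y) p x" and gibbs: "\<And>i y. f i y = gibbs_tuple p U V i y"
  shows "\<exists>\<epsilon>. 0 < \<epsilon> \<and> \<epsilon> < 1 \<and> convex_order M X N (\<lambda>\<omega>. (1 - \<epsilon>) *\<^sub>R Y \<omega>)"
proof -
  note fD = admissible_tuplesD[OF f]
  let ?Z = "\<lambda>y. (1::real, y)"
  have S: "0 < (\<Sum>j\<in>UNIV. p j * exp (U j + V j \<bullet> y))" for y
    by (rule weighted_exp_sum_pos[OF p_pos])
  have f_pos: "0 < f i y" for i y using S[of y] by (simp add: gibbs gibbs_tuple_def)
  have f_sum: "(\<Sum>i\<in>UNIV. p i * f i y) = 1" for y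
    using S[of y] by (simp add: gibbs gibbs_tuple_def flip: sum_divide_distrib)
  have f_int: "integrable \<nu> (f i)" "integrable \<nu> (\<lambda>y. f i y *\<^sub>R y)" for i
    using fD(4,5)[of i] by (auto simp: has_bochner_integral_iff)
  have Z_int: "integrable \<nu> (\<lambda>y. f i y *\<^sub>R ?Z y)" for i
    using integrable_Pair[OF f_int[of i]] by simp
  have Z_val: "(\<integral>y. f i y *\<^sub>R ?Z y \<partial>\<nu>) = (1, x i)" for i
    using integral_Pair[OF f_int[of i]] fD(4,5)[of i] by (simp add: has_bochner_integral_iff)
  have Z: "?Z \<in> borel_measurable \<nu>" by measurable
  have fm: "f i \<in> borel_measurable \<nu>" for i using fD(1)[of i] by measurable
  \<comment> \<open>The shift direction has mass component 0, so masses stay 1, and stretches the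
    mean along \<open>x i\<close>; centering makes these shifts cancel on average.\<close>
  have d0: "(\<Sum>i\<in>UNIV. p i *\<^sub>R (0::real, x i)) = 0"
    using mean by (simp add: sum_prod zero_prod_def)
  obtain \<delta> h where \<delta>: "0 < \<delta>" and h[measurable]: "\<And>i. h i \<in> borel_measurable \<nu>" and h_nn: "\<And>i y. 0 \<le> h i y"
    and h_sum: "\<And>y. (\<Sum>i\<in>UNIV. p i * h i y) = 1"
    and h_Z: "\<And>i. has_bochner_integral \<nu> (\<lambda>y. h i y *\<^sub>R ?Z y) ((\<integral>y. f i y *\<^sub>R ?Z y \<partial>\<nu>) + \<delta> *\<^sub>R (0, x i))"
    by (rule perturb_weights[OF Z absolutely_continuous_nondegenerate[OF prob_\<nu> ac] fm f_pos f_sum Z_int d0]) blast+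
  note h_Z = h_Z[unfolded Z_val]
  have h1: "has_bochner_integral \<nu> (h i) 1" for i
    using has_bochner_integral_bounded_linear[OF bounded_linear_fst h_Z[of i]] by simp
  have h2: "has_bochner_integral \<nu> (\<lambda>y. h i y *\<^sub>R y) ((1 + \<delta>) *\<^sub>R x i)" for i
    using has_bochner_integral_bounded_linear[OF bounded_linear_snd h_Z[of i]]
    by (simp add: scaleR_add_left)
  define \<epsilon> where "\<epsilon> = \<delta> / (1 + \<delta>)"
  have \<epsilon>: "0 < \<epsilon>" "\<epsilon> < 1" "(1 - \<epsilon>) * (1 + \<delta>) = 1"
    using \<delta> by (simp_all add: \<epsilon>_def field_simps)
  have "convex_order M X N (\<lambda>\<omega>. (1 - \<epsilon>) *\<^sub>R Y \<omega>)"
    by (rule convex_order_of_weights[OF M Y h h_nn h_sum h1 h2]) (simp add: \<epsilon>(3))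
  with \<epsilon> show ?thesis by blast
qed

lemma strict_convex_order_imp_gibbs:
  assumes M: "prob_space M" "X \<in> borel_measurable M" "distr M borel X = \<mu>"
    and Y[measurable]: "Y \<in> borel_measurable N" and Y_law: "distr N borel Y = \<nu>"
    and ac: "absolutely_continuous lborel \<nu>" and mean: "(\<Sum>i\<in>UNIV. p i *\<^sub>R x i) = 0"
    and int_\<nu>: "integrable \<nu> (\<lambda>y. y)" and mean_\<nu>: "(\<integral>y. y \<partial>\<nu>) = 0"
    and \<epsilon>: "0 < \<epsilon>" "\<epsilon> < 1" and ord: "convex_order M X N (\<lambda>\<omega>. (1 - \<epsilon>) *\<^sub>R Y \<omega>)"
  shows "\<exists>U V. gibbs_tuple p U V \<in> admissible_tuples \<nu> (\<lambda>y. y) p x"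
proof -
  interpret \<nu>: prob_space \<nu> by (rule prob_\<nu>)
  let ?Z = "\<lambda>y. (1::real, y)"
  \<comment> \<open>Chosen so that contracting by 1 - \<epsilon> towards the mean
    \<open>(1, 0)\<close> of \<open>?Z\<close> lands exactly on the required moment
    \<open>(1, x i)\<close>.\<close>
  let ?z = "\<lambda>i. (1::real, x i /\<^sub>R (1 - \<epsilon>))"
  have int_Z: "integrable \<nu> ?Z" by (rule integrable_Pair[OF _ int_\<nu>]) simp
  have E_Z: "(\<integral>y. ?Z y \<partial>\<nu>) = (1, 0)"
    using integral_Pair[OF \<nu>.integrable_const[of 1] int_\<nu>] by (simp add: mean_\<nu> \<nu>.prob_space)
  have z_mean: "(\<Sum>i\<in>UNIV. p i *\<^sub>R ?z i) = (\<integral>y. ?Z y \<partial>\<nu>)"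
  proof -
    have "(\<Sum>i\<in>UNIV. p i *\<^sub>R (x i /\<^sub>R (1 - \<epsilon>))) = (\<Sum>i\<in>UNIV. p i *\<^sub>R x i) /\<^sub>R (1 - \<epsilon>)"
      by (simp add: scaleR_sum_right mult.commute)
    then show ?thesis by (simp add: E_Z sum_prod mean p_sum)
  qed
  have dom: "(\<Sum>i\<in>UNIV. p i * (w $ i \<bullet> ?z i)) \<le> (\<integral>y. Max (range (\<lambda>i. w $ i \<bullet> ?Z y)) \<partial>\<nu>)"
    for w :: "(real \<times> 'a) ^ 'm"
  proof -
    let ?G = "\<lambda>y. Max (range (\<lambda>i. w $ i \<bullet> ?Z y))"
    \<comment> \<open>Rescaled slopes make \<open>g\<close> at
      \<open>(1 - \<epsilon>) *\<^sub>R y\<close> equal to the maximum at \<open>y\<close>, while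
      \<open>g (x i)\<close> dominates the pairing of \<open>w $ i\<close> with
      \<open>?z i\<close>.\<close>
    define g where "g y = Max (range (\<lambda>i. fst (w $ i) + (snd (w $ i) /\<^sub>R (1 - \<epsilon>)) \<bullet> y))" for y
    have g: "convex_on UNIV g" unfolding g_def by (rule convex_Max_affine)
    have gG: "g ((1 - \<epsilon>) *\<^sub>R y) = ?G y" for y
    proof -
      have cancel: "(u /\<^sub>R (1 - \<epsilon>)) \<bullet> ((1 - \<epsilon>) *\<^sub>R y) = u \<bullet> y" for u :: 'a using \<epsilon> by simp
      show ?thesis unfolding g_def cancel by (simp add: inner_prod_def)
    qed
    have int_G: "integrable \<nu> ?G"
      by (rule shift_mono_integrable[OF prob_\<nu> int_Z shift_mono_Max])
    then have "?G \<in> borel_measurable borel"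
      using measurable_cong_sets[OF sets_\<nu> refl] by blast
    from integrable_distr_eq[OF Y this] integral_distr[OF Y this] int_G
    have "ext_expectation N (\<lambda>\<omega>. ?G (Y \<omega>)) = ereal (\<integral>y. ?G y \<partial>\<nu>)"
      by (simp only: Y_law ext_expectation_integrable)
    moreover have "ext_expectation M (\<lambda>\<omega>. g (X \<omega>)) \<le> ext_expectation N (\<lambda>\<omega>. g ((1 - \<epsilon>) *\<^sub>R Y \<omega>))"
      using ord g unfolding convex_order_def by blast
    then have "ext_expectation M (\<lambda>\<omega>. g (X \<omega>)) \<le> ext_expectation N (\<lambda>\<omega>. ?G (Y \<omega>))"
      by (simp only: gG)
    ultimately have "(\<Sum>i\<in>UNIV. p i * g (x i)) \<le> (\<integral>y. ?G y \<partial>\<nu>)"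
      by (simp add: ext_expectation_source[OF M g])
    moreover have "(\<Sum>i\<in>UNIV. p i * (w $ i \<bullet> ?z i)) \<le> (\<Sum>i\<in>UNIV. p i * g (x i))"
    proof (intro sum_mono mult_left_mono)
      fix i
      have "fst (w $ i) + (snd (w $ i) /\<^sub>R (1 - \<epsilon>)) \<bullet> x i \<le> g (x i)"
        unfolding g_def by (intro Max_ge) auto
      then show "w $ i \<bullet> ?z i \<le> g (x i)" by (simp add: inner_prod_def)
    qed (use p_pos in \<open>auto simp: less_imp_le\<close>)
    ultimately show ?thesis by linarith
  qed
  obtain w :: "(real \<times> 'a) ^ 'm" where w: "\<And>i.
      (\<integral>y. (exp (w $ i \<bullet> ?Z y) / (\<Sum>j\<in>UNIV. p j * exp (w $ j \<bullet> ?Z y))) *\<^sub>R ?Z y \<partial>\<nu>)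
      = (1 - \<epsilon>) *\<^sub>R ?z i + \<epsilon> *\<^sub>R (\<integral>y. ?Z y \<partial>\<nu>)"
    by (rule exists_gibbs_weights[OF prob_\<nu> int_Z absolutely_continuous_nondegenerate[OF prob_\<nu> ac]
          p_pos p_sum \<epsilon> z_mean dom]) blast+
  define U where "U i = fst (w $ i)" for i
  define V where "V i = snd (w $ i)" for i
  let ?f = "gibbs_tuple p U V"
  have f: "?f i y = exp (w $ i \<bullet> ?Z y) / (\<Sum>j\<in>UNIV. p j * exp (w $ j \<bullet> ?Z y))" for i y
    by (simp add: gibbs_tuple_def U_def V_def inner_prod_def)
  have S: "0 < (\<Sum>j\<in>UNIV. p j * exp (U j + V j \<bullet> y))" for y
    by (rule weighted_exp_sum_pos[OF p_pos])
  have hb: "has_bochner_integral \<nu> (\<lambda>y. ?f i y *\<^sub>R ?Z y) (1, x i)" for i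
  proof -
    have "integrable \<nu> (\<lambda>y. ?f i y *\<^sub>R ?Z y)"
      unfolding f by (rule integrable_gibbs_weight[OF int_Z p_pos])
    moreover have "(\<integral>y. ?f i y *\<^sub>R ?Z y \<partial>\<nu>) = (1, x i)"
      unfolding f w E_Z using \<epsilon> by simp
    ultimately show ?thesis by (simp add: has_bochner_integral_iff)
  qed
  \<comment> \<open>The two projections of the single vector moment \<open>hb\<close> are the mass
    and the mean condition.\<close>
  have "has_bochner_integral \<nu> (?f i) 1" "has_bochner_integral \<nu> (\<lambda>y. ?f i y *\<^sub>R y) (x i)" for i
    using has_bochner_integral_bounded_linear[OF bounded_linear_fst hb[of i]]
      has_bochner_integral_bounded_linear[OF bounded_linear_snd hb[of i]] by simp_all
  moreover have "?f i \<in> borel_measurable borel" for i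
    unfolding gibbs_tuple_def[abs_def] by measurable
  moreover have "0 \<le> ?f i y" for i y
    using S[of y] by (simp add: gibbs_tuple_def)
  moreover have "(\<Sum>i\<in>UNIV. p i * ?f i y) = 1" for y
    using S[of y] by (simp add: gibbs_tuple_def flip: sum_divide_distrib)
  ultimately have "?f \<in> admissible_tuples \<nu> (\<lambda>y. y) p x"
    unfolding admissible_tuples_def by auto
  then show ?thesis by blast
qed

end

theorem proposition3p3:
  fixes \<mu> \<nu> :: "(real ^ 'n) measure"
    and p :: "'m::finite \<Rightarrow> real" and x :: "'m \<Rightarrow> real ^ 'n"
    and M :: "'s measure" and X :: "'s \<Rightarrow> real ^ 'n"
    and N :: "'t measure" and Y :: "'t \<Rightarrow> real ^ 'n"
    and C :: "('m \<Rightarrow> real ^ 'n \<Rightarrow> real) set"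
  defines "C \<equiv> admissible_tuples N Y p x"
  assumes "inj x" and "\<And>i. 0 < p i" and "(\<Sum>i\<in>UNIV. p i) = 1"
    and "sets \<mu> = sets borel"
    and "\<And>A. A \<in> sets borel \<Longrightarrow>
           emeasure \<mu> A = (\<Sum>i\<in>UNIV. ennreal (p i) * emeasure (return borel (x i)) A)"
    and "(\<integral>z. z \<partial>\<mu>) = 0"
    and "prob_space \<nu>" and "sets \<nu> = sets borel"
    and "absolutely_continuous lborel \<nu>"
    and "integrable \<nu> (\<lambda>y. y)" and "(\<integral>y. y \<partial>\<nu>) = 0"
    and "measure_convex_order \<mu> \<nu>"
    and "prob_space M" and "X \<in> borel_measurable M" and "distr M borel X = \<mu>"
    and "prob_space N" and "Y \<in> borel_measurable N" and "distr N borel Y = \<nu>"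
  shows "bij_betw (\<lambda>\<pi>. ae_eq_tuples \<nu> C `` {coupling_tuple \<pi> fst snd x})
           (martingale_coupling_laws \<mu> \<nu>) (C // ae_eq_tuples \<nu> C)
       \<and> ((\<exists>\<epsilon>. 0 < \<epsilon> \<and> \<epsilon> < 1 \<and> convex_order M X N (\<lambda>\<omega>. (1 - \<epsilon>) *\<^sub>R Y \<omega>)) \<longleftrightarrow>
            (\<exists>f\<in>C. \<exists>U V. \<forall>i y. f i y = gibbs_tuple p U V i y))
       \<and> (\<forall>f\<in>C. \<forall>U V. (\<forall>i y. f i y = gibbs_tuple p U V i y) \<longrightarrow> (\<forall>i. log_concave (f i)))"
proof -
  interpret finite_source \<mu> \<nu> p x
    by (intro finite_source.intro allI assms(2-6) assms(8,9))
  note M = assms(14-16) and Y = assms(18,19)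
  have C: "C = admissible_tuples \<nu> (\<lambda>y. y) p x"
    unfolding C_def using admissible_tuples_distr[OF Y(1)] by (simp only: Y(2))
  \<comment> \<open>Centering of \<mu> in terms of its atoms, the form that both implications
    use.\<close>
  have mean: "(\<Sum>i\<in>UNIV. p i *\<^sub>R x i) = 0"
  proof -
    have "(\<Sum>i\<in>UNIV. p i *\<^sub>R x i) = (\<integral>\<omega>. X \<omega> \<partial>M)"
      using has_bochner_integral_source[OF M, of "\<lambda>z. z"] by (simp add: has_bochner_integral_iff)
    also have "\<dots> = (\<integral>z. z \<partial>\<mu>)"
      using integral_distr[OF M(2), of "\<lambda>z. z"] by (simp add: M(3))
    finally show ?thesis by (simp add: assms(7))
  qed
  show ?thesis
  proof (intro conjI iffI)
    show "bij_betw (\<lambda>\<pi>. ae_eq_tuples \<nu> C `` {coupling_tuple \<pi> fst snd x})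
           (martingale_coupling_laws \<mu> \<nu>) (C // ae_eq_tuples \<nu> C)"
      unfolding C by (rule coupling_tuple_bij_betw[OF assms(11)])
    show "\<exists>f\<in>C. \<exists>U V. \<forall>i y. f i y = gibbs_tuple p U V i y"
      if "\<exists>\<epsilon>. 0 < \<epsilon> \<and> \<epsilon> < 1 \<and> convex_order M X N (\<lambda>\<omega>. (1 - \<epsilon>) *\<^sub>R Y \<omega>)"
      using that strict_convex_order_imp_gibbs[OF M Y assms(10) mean assms(11,12)] unfolding C by blast
    show "\<exists>\<epsilon>. 0 < \<epsilon> \<and> \<epsilon> < 1 \<and> convex_order M X N (\<lambda>\<omega>. (1 - \<epsilon>) *\<^sub>R Y \<omega>)"
      if "\<exists>f\<in>C. \<exists>U V. \<forall>i y. f i y = gibbs_tuple p U V i y"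
      using that gibbs_imp_strict_convex_order[OF M Y assms(10) mean] unfolding C by blast
    show "\<forall>f\<in>C. \<forall>U V. (\<forall>i y. f i y = gibbs_tuple p U V i y) \<longrightarrow> (\<forall>i. log_concave (f i))"
      using gibbs_log_concave[OF p_pos] by blast
  qed
qed

end
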